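(* For complex $q$ with $|q|<1$, $$\varphi(q)\varphi(q^{27}) = \frac{\varphi(q)\varphi(q^3) - \varphi(q^3)\varphi(q^9)}{3} + \varphi(q^9)\varphi(q^{27}) + \frac{4}{3}qE(q^6)E(q^{18}).$$ For a positive integer $n$, let $a(n)$ be the number of $(x,y)\in\mathbb{Z}^2$ with $x^2+27y^2=n$ and $b(n)$ the number of $(x,y)\in\mathbb{Z}^2$ with $4x^2+2xy+7y^2=n$. If $n \not\equiv 1 \pmod{6}$, write $n = 2^\alpha 3^\beta \prod_{i=1}^r p_i^{v_i} \prod_{j=1}^s q_j^{w_j}$ where the $p_i$ are the distinct primes dividing $n$ with $p_i \equiv 1 \pmod 3$ and the $q_j$ are the distinct primes $q_j\neq 2$ dividing $n$ with $q_j \equiv 2 \pmod 3$. Then $$a(n) = b(n) = \begin{cases} (3 - 2\delta_{\alpha,0})(1 + (-1)^\alpha) \prod_{i=1}^r (1 + v_i) \prod_{j=1}^s \frac{1 + (-1)^{w_j}}{2} & \text{if } \beta \geq 2, \\ (1 + (-1)^\alpha) \prod_{i=1}^r (1 + v_i) \prod_{j=1}^s \frac{1 + (-1)^{w_j}}{2} & \text{if } \beta = 0 \text{ and } \alpha > 0, \\ 0 & \text{otherwise,} \end{cases}$$ where $\delta_{\alpha,0}=1$ if $\alpha=0$ and $0$ otherwise. If $n \equiv 1 \pmod{6}$, write $n = \prod_{i=1}^r p_i^{v_i} \prod_{i=1}^s q_i^{u_i} \prod_{i=1}^t Q_i^{w_i}$, where the $p_i$ are the distinct primes dividing $n$ with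 $p_i \equiv 1 \pmod{3}$ and $2^{(p_i-1)/3} \equiv 1 \pmod{p_i}$, the $q_i$ are the distinct primes dividing $n$ with $q_i \equiv 1 \pmod{3}$ and $2^{(q_i-1)/3} \not\equiv 1 \pmod{q_i}$, and the $Q_i$ are the distinct primes $Q_i\neq 2$ dividing $n$ with $Q_i \equiv 2 \pmod{3}$. Then $$a(n) = \frac{2}{3} \prod_{i=1}^r (1 + v_i) \left(\prod_{i=1}^s (1 + u_i) + 2 \prod_{i=1}^s \left(\frac{1 + u_i}{3}\right) \right) \prod_{i=1}^t \frac{1 + (-1)^{w_i}}{2},$$ $$b(n) = \frac{2}{3} \prod_{i=1}^r (1 + v_i) \left(\prod_{i=1}^s (1 + u_i) - \prod_{i=1}^s \left(\frac{1 + u_i}{3}\right) \right) \prod_{i=1}^t \frac{1 + (-1)^{w_i}}{2}.$$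
   Context: For $|q|<1$: $E(q):=\prod_{n\ge 1}(1-q^n)$ and $\varphi(q):=\sum_{n=-\infty}^{\infty} q^{n^2}$. $\left(\frac{m}{3}\right)$ is the Legendre symbol modulo 3 ($0$ if $3\mid m$, $1$ if $m\equiv1$, $-1$ if $m\equiv 2 \pmod 3$). *)

theory Defs
  imports "HOL-Analysis.Analysis" "HOL-Number_Theory.Number_Theory"
begin

(* The factor for the library index n is the one for n + 1 in the usual product from n = 1. *)
definition euler_E :: "complex \<Rightarrow> complex" where
  "euler_E q = (\<Prod>n. 1 - q ^ Suc n)"

definition ramanujan_phi :: "complex \<Rightarrow> complex" where
  "ramanujan_phi q = (\<Sum>\<^sub>\<infinity>n::int. q powi (n\<^sup>2))"

definition rep_a :: "nat \<Rightarrow> nat" where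
  "rep_a n = card {(x::int, y::int). x\<^sup>2 + 27 * y\<^sup>2 = int n}"

definition rep_b :: "nat \<Rightarrow> nat" where
  "rep_b n = card {(x::int, y::int). 4 * x\<^sup>2 + 2 * x * y + 7 * y\<^sup>2 = int n}"

end

theory Submission
  imports Defs
begin

text \<open>
  Both counting functions and the theta identity are read off from the norm forms of orders in
  \<open>\<int>[\<omega>]\<close>, \<open>\<omega>\<close> a primitive cube root of unity. Multiplication by \<open>\<omega>\<close> permutes the integer points
  of \<open>x\<^sup>2 + 3y\<^sup>2\<close> with \<open>x \<equiv> y (mod 2)\<close>, which settles these points in the theta identity; the remaining
  ones are matched with the double series that the pentagonal number theorem gives for
  \<open>q E(q\<^sup>6) E(q\<^sup>1\<^sup>8)\<close>.

  The form \<open>Q = x\<^sup>2 - 3xy + 9y\<^sup>2\<close> is the norm of \<open>x + 3y\<omega>\<close>. Its solutions with \<open>y\<close> even, \<open>x\<close> even and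
  \<open>x \<equiv> y (mod 2)\<close> are counted by \<open>a\<close>, \<open>b\<close> and \<open>b\<close>. Hence for odd \<open>n\<close> it suffices to know \<open>a + 2b\<close>, the number
  of all solutions, and \<open>2a - 2b\<close>, the sum over them of the real cubic weight \<open>2, -1, -1\<close> of the parity
  class. Both satisfy Hecke recursions at the primes \<open>p > 3\<close>. At \<open>p \<equiv> 1 (mod 3)\<close> these come from
  multiplication by an element of norm \<open>p\<close> and by its conjugate. Such an element is the Jacobi sum
  \<open>J = \<Sum> \<chi>(t) \<chi>(1 - t)\<close> of a cubic character; as \<open>J \<equiv> \<chi>(2) (mod 2)\<close>, its weight
  decides whether 2 is a cubic residue.
\<close>

section \<open>The pentagonal number theorem and the theta identity\<close>

text \<open>\<open>rep_a\<close> and \<open>rep_b\<close> are not multiplicative one at a time: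
  their forms are the principal and a non-principal class of discriminant -108, where the class
  group has order 3. The total count and the weighted sum are the combinations on which each prime p
  > 3 acts by a recursion. That a prime p congruent to 1 mod 3 is a norm from the small order
  Z[3 omega], and not merely from Z[omega], comes from a congruence for the Jacobi sum modulo 3
  rather than from unique factorization. Two cases escape this scheme. For even n the weight
  vanishes, but then each solution satisfies all three parity conditions, so a = b = total. For n
  divisible by 3 all solutions lie in 3 Z[omega], where omega acts: for odd n this gives a = b, and
  for multiples of 9 it makes the total three times that of the part of n prime to 3.\<close>

text \<open>Shanks' finite form of the pentagonal number theorem: for s = 0 the left side has the
  partial Euler product, and every other term carries a factor q^n. \<open>T\<close> enters through
  its recursion, so that the triangular exponents involve no halving.\<close>

lemma shanks_pentagonal:
  fixes q :: "'a :: comm_ring_1" and T :: "nat \<Rightarrow> nat"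
  assumes T0: "T 0 = 0" and TS: "\<And>k. T (Suc k) = T k + Suc k"
  shows "(\<Sum>s\<le>n. (-1)^s * (\<Prod>j\<in>{s<..n}. 1 - q^j) * q^(s*n + T s)) =
         1 + (\<Sum>k<n. (-1)^Suc k * (q^(Suc k * Suc k + T k) + q^(Suc k * Suc k + T (Suc k))))"
proof (induction n)
  case 0
  show ?case by (simp add: T0)
next
  case (Suc n)
  define U where "U s = (-1)^s * (\<Prod>j\<in>{s<..n}. 1 - q^j) * q^(s * Suc n + T s)" for s
  define V where "V s = (-1)^s * (\<Prod>j\<in>{s<..n}. 1 - q^j) * q^(s*n + T s)" for s
  \<comment> \<open>Passing from n to n + 1 turns the summand \<open>V s\<close> into
    \<open>U s * (1 - q^Suc n)\<close>. Since
    \<open>U (Suc s) - V (Suc s) = U s * q ^ Suc n\<close>, the differences collapse to one boundary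
    term.\<close>
  have tele: "(\<Sum>s\<le>m. U s * (1 - q^Suc n) - V s) = - U m * q ^ Suc n" if "m \<le> n" for m
    using that
  proof (induction m)
    case 0
    show ?case by (simp add: U_def V_def T0 algebra_simps)
  next
    case (Suc m)
    define P where "P = (\<Prod>j\<in>{Suc m<..n}. 1 - q^j)"
    define X where "X = q^(Suc m * Suc n + T m)"
    have P': "(\<Prod>j\<in>{m<..n}. 1 - q^j) = (1 - q ^ Suc m) * P"
    proof -
      have "{m<..n} = insert (Suc m) {Suc m<..n}" using Suc.prems by auto
      thus ?thesis by (simp add: P_def)
    qed
    have U1: "U (Suc m) = (-1)^Suc m * P * (q ^ Suc m * X)"
      by (simp only: U_def P_def X_def TS power_add mult_ac)
    have "q ^ (m * Suc n + T m) * q ^ Suc n = X"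
      by (simp add: X_def power_add mult_ac)
    hence U2: "U m * q ^ Suc n = (-1)^m * ((1 - q^Suc m) * P) * X"
      unfolding U_def P' by (metis mult.assoc)
    have "Suc m * n + T (Suc m) = Suc m * Suc n + T m" by (simp add: TS)
    hence V1: "V (Suc m) = (-1)^Suc m * P * X"
      unfolding V_def P_def X_def by (simp only:)
    have "U (Suc m) - V (Suc m) = U m * q ^ Suc n"
      unfolding U1 V1 U2 by (simp add: algebra_simps)
    thus ?case using Suc by (simp add: algebra_simps)
  qed
  have last: "U n = (-1)^n * q^(n * Suc n + T n)" by (simp add: U_def)
  have U_prod: "(-1)^s * (\<Prod>j\<in>{s<..Suc n}. 1 - q^j) * q^(s * Suc n + T s) = U s * (1 - q^Suc n)"
    if "s \<le> n" for s
  proof -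
    have "{s<..Suc n} = insert (Suc n) {s<..n}" using that by auto
    thus ?thesis by (simp add: U_def mult_ac)
  qed
  have "(\<Sum>s\<le>Suc n. (-1)^s * (\<Prod>j\<in>{s<..Suc n}. 1 - q^j) * q^(s * Suc n + T s)) =
        (\<Sum>s\<le>n. U s * (1 - q^Suc n)) + (-1)^Suc n * q^(Suc n * Suc n + T (Suc n))"
    using U_prod by simp
  also have "(\<Sum>s\<le>n. U s * (1 - q^Suc n)) = (\<Sum>s\<le>n. V s) - U n * q ^ Suc n"
    using tele[of n] by (simp only: sum_subtractf diff_eq_eq order_refl mult_minus_left) simp
  \<comment> \<open>The boundary term supplies the exponent with \<open>T n\<close>, the new summand
    s = n + 1 the one with \<open>T (Suc n)\<close>: the two pentagonal numbers of index n +
    1.\<close>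
  also have "U n * q ^ Suc n = - ((-1)^Suc n * q^(Suc n * Suc n + T n))"
    by (simp add: last power_add mult_ac)
  finally show ?case
    using Suc.IH by (simp add: V_def algebra_simps)
qed

section \<open>Series over the integers and the limit of Shanks' identity\<close>

lemma summable_on_power_nat_abs:
  fixes r :: real
  assumes "0 \<le> r" "r < 1"
  shows "(\<lambda>m::int. r ^ nat \<bar>m\<bar>) summable_on UNIV"
proof -
  have s: "(\<lambda>n::nat. r ^ n) summable_on UNIV"
    using assms by (intro summable_nonneg_imp_summable_on) auto
  have "(\<lambda>m::int. r ^ nat \<bar>m\<bar>) summable_on {0..}"
    using s by (subst summable_on_reindex_bij_witness[of "{0..}" int nat UNIV "\<lambda>n. r ^ n"]) auto
  moreover have "(\<lambda>m::int. r ^ nat \<bar>m\<bar>) summable_on {..0}"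
    using s by (subst summable_on_reindex_bij_witness
        [of "{..0}" "\<lambda>n. - int n" "\<lambda>m. nat (-m)" UNIV "\<lambda>n. r ^ n"]) auto
  ultimately have "(\<lambda>m::int. r ^ nat \<bar>m\<bar>) summable_on ({0..} \<union> {..0})"
    by (rule summable_on_union)
  moreover have "{0..} \<union> {..0} = (UNIV :: int set)" by auto
  ultimately show ?thesis by simp
qed

lemma abs_summable_on_power_int:
  fixes q :: complex and c :: "int \<Rightarrow> complex" and e :: "int \<Rightarrow> int"
  assumes "norm q < 1" "\<And>m. norm (c m) \<le> 1" "\<And>m. \<bar>m\<bar> \<le> e m"
  shows "(\<lambda>m. norm (c m * q ^ nat (e m))) summable_on UNIV"
proof (rule summable_on_comparison_test)
  show "(\<lambda>m::int. norm q ^ nat \<bar>m\<bar>) summable_on UNIV"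
    using assms by (intro summable_on_power_nat_abs) auto
  fix m :: int
  have "norm (c m * q ^ nat (e m)) \<le> 1 * norm q ^ nat (e m)"
    unfolding norm_mult norm_power using assms(2)[of m] by (intro mult_right_mono) auto
  also have "\<dots> \<le> norm q ^ nat \<bar>m\<bar>"
    using assms(1,3) by (auto intro!: power_decreasing nat_mono)
  finally show "norm (c m * q ^ nat (e m)) \<le> norm q ^ nat \<bar>m\<bar>" .
qed simp

text \<open>Shanks' identity pairs the indices k and -k, whereas \<open>has_sum\<close> is a limit
  over all finite sets. Symmetric intervals eventually contain every finite set, so the paired
  partial sums have the same limit.\<close>

lemma has_sum_int_symmetric:
  fixes f :: "int \<Rightarrow> 'a :: real_normed_vector"
  assumes "(f has_sum S) UNIV"
  shows "(\<lambda>n. f 0 + (\<Sum>k<n. f (int (Suc k)) + f (- int (Suc k)))) \<longlonglongrightarrow> S"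
proof -
  have "filterlim (\<lambda>n. {-int n..int n}) (finite_subsets_at_top UNIV) sequentially"
    unfolding filterlim_finite_subsets_at_top
  proof safe
    fix X :: "int set" assume "finite X"
    then obtain B where B: "\<And>x. x \<in> X \<Longrightarrow> \<bar>x\<bar> \<le> B"
      using Max_ge[of "abs ` X"] by (metis finite_imageI imageI)
    have "X \<subseteq> {-int n..int n}" if "n \<ge> nat B" for n
    proof
      fix x assume "x \<in> X"
      from B[OF this] that show "x \<in> {-int n..int n}" by auto
    qed
    thus "\<forall>\<^sub>F n in sequentially. finite {- int n..int n} \<and> X \<subseteq> {- int n..int n} \<and> {- int n..int n} \<subseteq> UNIV"
      by (auto simp: eventually_at_top_linorder)
  qed
  from filterlim_compose[OF assms[unfolded has_sum_def] this]
  have "(\<lambda>n. sum f {-int n..int n}) \<longlonglongrightarrow> S" .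
  moreover have "sum f {-int n..int n} = f 0 + (\<Sum>k<n. f (int (Suc k)) + f (- int (Suc k)))" for n
  proof (induction n)
    case (Suc n)
    have "{-int (Suc n)..int (Suc n)} = insert (int (Suc n)) (insert (-int (Suc n)) {-int n..int n})"
      by auto
    hence "sum f {-int (Suc n)..int (Suc n)} = f (int (Suc n)) + (f (-int (Suc n)) + sum f {-int n..int n})"
      by simp
    thus ?case using Suc by (simp add: algebra_simps)
  qed simp
  ultimately show ?thesis by simp
qed

text \<open>A bound uniform in \<open>A\<close>, for the tail products in Shanks' sum; 1 + x \<le>
  exp x reduces it to the geometric series.\<close>

lemma norm_prod_one_minus_power_le:
  fixes q :: complex
  assumes "norm q < 1" "finite A"
  shows "norm (\<Prod>j\<in>A. 1 - q^j) \<le> exp (1 / (1 - norm q))"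
proof -
  have "norm (\<Prod>j\<in>A. 1 - q^j) \<le> (\<Prod>j\<in>A. exp (norm q ^ j))"
    unfolding prod_norm[symmetric]
  proof (intro prod_mono conjI)
    fix j
    have "norm (1 - q^j) \<le> 1 + norm q ^ j"
      by (metis norm_triangle_ineq4 norm_one norm_power)
    also have "\<dots> \<le> exp (norm q ^ j)" by (rule exp_ge_add_one_self)
    finally show "norm (1 - q ^ j) \<le> exp (norm q ^ j)" .
  qed auto
  also have "\<dots> = exp (\<Sum>j\<in>A. norm q ^ j)" using assms(2) by (simp add: exp_sum)
  also have "(\<Sum>j\<in>A. norm q ^ j) \<le> (\<Sum>j. norm q ^ j)"
    using assms by (intro sum_le_suminf) auto
  also have "\<dots> = 1 / (1 - norm q)" using assms by (intro suminf_geometric) auto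
  finally show ?thesis by simp
qed

lemma pentagonal_number_theorem:
  fixes q :: complex
  assumes q: "norm q < 1"
  shows "euler_E q = (\<Sum>\<^sub>\<infinity>m::int. (-1) ^ nat \<bar>m\<bar> * q ^ nat (m * (3*m+1) div 2))"
proof -
  define f where "f m = (-1) ^ nat \<bar>m\<bar> * q ^ nat (m * (3*m+1) div 2)" for m :: int
  define T :: "nat \<Rightarrow> nat" where "T k = k * (k+1) div 2" for k
  have T0: "T 0 = 0" and TS: "\<And>k. T (Suc k) = T k + Suc k" by (auto simp: T_def)
  have "(\<lambda>x. norm (f x)) summable_on UNIV"
    unfolding f_def
  proof (rule abs_summable_on_power_int[OF q])
    fix m :: int
    have "2 * \<bar>m\<bar> \<le> m * (3*m+1)"
    proof (cases "m \<ge> 0")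
      case True
      have "m * m \<ge> m" using True by (cases "m = 0") (auto simp: mult_le_cancel_left1)
      thus ?thesis using True by (simp add: algebra_simps)
    next
      case False
      hence "m * (m + 1) \<ge> 0" by (intro mult_nonpos_nonpos) auto
      thus ?thesis using False by (simp add: algebra_simps)
    qed
    thus "\<bar>m\<bar> \<le> m * (3*m+1) div 2" by linarith
  qed (simp add: norm_power)
  hence "(f has_sum (infsum f UNIV)) UNIV"
    by (rule has_sum_infsum[OF Infinite_Sum.abs_summable_summable])
  hence lim1: "(\<lambda>n. f 0 + (\<Sum>k<n. f (int (Suc k)) + f (- int (Suc k)))) \<longlonglongrightarrow> infsum f UNIV"
    by (rule has_sum_int_symmetric)
  define F where "F n = (\<Sum>s\<le>n. (-1)^s * (\<Prod>j\<in>{s<..n}. 1 - q^j) * q^(s*n + T s))" for n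
  \<comment> \<open>For m = k + 1 the pentagonal exponents are m(3m+1)/2 = m^2 + T(m) at index m and
    m(3m-1)/2 = m^2 + T(m-1) at index -m.\<close>
  have f_pos: "f (int (Suc k)) = (-1) ^ Suc k * q ^ (Suc k * Suc k + T (Suc k))" for k
  proof -
    have "even (Suc k * (Suc k + 1))" by simp
    hence "2 * T (Suc k) = Suc k * (Suc k + 1)" unfolding T_def by simp
    hence "2 * int (T (Suc k)) = int (Suc k) * (int (Suc k) + 1)"
      by (simp only: of_nat_eq_iff[where 'a = int, symmetric] of_nat_mult of_nat_add of_nat_1 of_nat_numeral)
    hence "int (Suc k) * (3 * int (Suc k) + 1) = 2 * int (Suc k * Suc k + T (Suc k))"
      by (simp add: algebra_simps)
    hence "nat (int (Suc k) * (3 * int (Suc k) + 1) div 2) = Suc k * Suc k + T (Suc k)" by (metis nat_int nonzero_mult_div_cancel_left zero_neq_numeral)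
    moreover have "nat \<bar>int (Suc k)\<bar> = Suc k" by simp
    ultimately show ?thesis unfolding f_def by metis
  qed
  have f_neg: "f (- int (Suc k)) = (-1) ^ Suc k * q ^ (Suc k * Suc k + T k)" for k
  proof -
    have "even (k * (k + 1))" by simp
    hence "2 * T k = k * (k + 1)" unfolding T_def by simp
    hence "2 * int (T k) = int k * (int k + 1)"
      by (simp only: of_nat_eq_iff[where 'a = int, symmetric] of_nat_mult of_nat_add of_nat_1 of_nat_numeral)
    hence "- int (Suc k) * (3 * (- int (Suc k)) + 1) = 2 * int (Suc k * Suc k + T k)"
      by (simp add: algebra_simps)
    hence "nat (- int (Suc k) * (3 * (- int (Suc k)) + 1) div 2) = Suc k * Suc k + T k" by (metis nat_int nonzero_mult_div_cancel_left zero_neq_numeral)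
    moreover have "nat \<bar>- int (Suc k)\<bar> = Suc k" by simp
    ultimately show ?thesis unfolding f_def by metis
  qed
  have F_eq: "F n = f 0 + (\<Sum>k<n. f (int (Suc k)) + f (- int (Suc k)))" for n
    unfolding F_def shanks_pentagonal[OF T0 TS] f_pos f_neg by (simp add: f_def algebra_simps)
  have lim2: "F \<longlonglongrightarrow> infsum f UNIV" using lim1 by (simp add: F_eq[abs_def])
  define P where "P n = (\<Prod>j\<in>{0<..n}. 1 - q^j)" for n
  define C where "C = exp (1 / (1 - norm q))"
  \<comment> \<open>Each of the n terms with s \<ge> 1 has a factor q^n and a bounded tail product,
    so together they are O(n |q|^n).\<close>
  have F_P: "norm (F n - P n) \<le> C * (of_nat n * norm q ^ n)" for n
  proof -
    have "F n = P n + (\<Sum>s\<in>{1..n}. (-1)^s * (\<Prod>j\<in>{s<..n}. 1 - q^j) * q^(s*n + T s))"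
    proof -
      have "{..n} = insert 0 {1..n}" by auto
      thus ?thesis by (simp add: F_def P_def T0)
    qed
    hence "norm (F n - P n) \<le> (\<Sum>s\<in>{1..n}. norm ((-1)^s * (\<Prod>j\<in>{s<..n}. 1 - q^j) * q^(s*n + T s)))"
      by (simp add: norm_sum)
    also have "\<dots> \<le> (\<Sum>s\<in>{1..n}. C * norm q ^ n)"
    proof (rule sum_mono)
      fix s assume s: "s \<in> {1..n}"
      have "norm q ^ (s*n + T s) \<le> norm q ^ n"
      proof (rule power_decreasing)
        have "1 * n \<le> s * n" using s by (intro mult_right_mono) auto
        thus "n \<le> s * n + T s" by linarith
      qed (use q in auto)
      thus "norm ((-1)^s * (\<Prod>j\<in>{s<..n}. 1 - q^j) * q^(s*n + T s)) \<le> C * norm q ^ n"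
        unfolding norm_mult norm_power C_def
        using norm_prod_one_minus_power_le[OF q, of "{s<..n}"] by (intro mult_mono) auto
    qed
    finally show ?thesis by (simp add: mult_ac)
  qed
  have "(\<lambda>n. C * (of_nat n * norm q ^ n)) \<longlonglongrightarrow> C * 0"
    using q by (intro tendsto_mult_left powser_times_n_limit_0) auto
  hence "(\<lambda>n. C * (of_nat n * norm q ^ n)) \<longlonglongrightarrow> 0" by simp
  hence "(\<lambda>n. F n - P n) \<longlonglongrightarrow> 0"
    by (rule Lim_null_comparison[rotated]) (use F_P in simp)
  from tendsto_diff[OF lim2 this] have lim3: "P \<longlonglongrightarrow> infsum f UNIV" by simp
  have "convergent_prod (\<lambda>n. 1 - q ^ Suc n)"
  proof (rule abs_convergent_prod_imp_convergent_prod, rule summable_imp_abs_convergent_prod)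
    have "summable (\<lambda>n. norm q * norm q ^ n)" using q by (intro summable_mult) auto
    thus "summable (\<lambda>i. norm (1 - q ^ Suc i - 1))" by (simp add: norm_mult norm_power)
  qed
  hence "(\<lambda>n. \<Prod>i\<le>n. 1 - q ^ Suc i) \<longlonglongrightarrow> euler_E q"
    unfolding euler_E_def by (rule convergent_prod_LIMSEQ)
  moreover have "(\<Prod>i\<le>n. 1 - q ^ Suc i) = P (Suc n)" for n
    unfolding P_def by (rule prod.reindex_bij_witness[of _ "\<lambda>i. i - 1" Suc]) auto
  ultimately have "(\<lambda>n. P (Suc n)) \<longlonglongrightarrow> euler_E q" by simp
  moreover have "(\<lambda>n. P (Suc n)) \<longlonglongrightarrow> infsum f UNIV" using lim3 by (rule LIMSEQ_Suc)
  ultimately show ?thesis using LIMSEQ_unique unfolding f_def by blast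
qed

section \<open>Double series for products of theta functions and Euler products\<close>

lemma infsum_mult_abs_summable:
  fixes f g :: "int \<Rightarrow> complex"
  assumes f: "(\<lambda>x. norm (f x)) summable_on UNIV" and g: "(\<lambda>x. norm (g x)) summable_on UNIV"
  shows "(\<lambda>(x,y). f x * g y) summable_on UNIV"
    and "infsum f UNIV * infsum g UNIV = (\<Sum>\<^sub>\<infinity>(x,y). f x * g y)"
proof -
  have "(\<lambda>z. norm (case z of (x,y) \<Rightarrow> f x * g y)) summable_on (UNIV \<times> UNIV)"
    unfolding Infinite_Sum.abs_summable_on_Sigma_iff
  proof (intro conjI ballI)
    fix x show "(\<lambda>y. norm (case (x, y) of (x, y) \<Rightarrow> f x * g y)) summable_on UNIV"
      using g by (simp add: norm_mult summable_on_cmult_right)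
    have "(\<lambda>x. norm (f x) * infsum (\<lambda>y. norm (g y)) UNIV) summable_on UNIV"
      using f by (rule summable_on_cmult_left)
    moreover have "0 \<le> infsum (\<lambda>y. norm (g y)) UNIV" by (rule infsum_nonneg) auto
    ultimately show "(\<lambda>x. norm (\<Sum>\<^sub>\<infinity>y. norm (case (x, y) of (x, y) \<Rightarrow> f x * g y))) summable_on UNIV"
      by (simp add: norm_mult infsum_cmult_right')
  qed
  hence s: "(\<lambda>(x,y). f x * g y) summable_on (UNIV \<times> UNIV)" by (rule Infinite_Sum.abs_summable_summable)
  thus "(\<lambda>(x,y). f x * g y) summable_on UNIV" by simp
  show "infsum f UNIV * infsum g UNIV = (\<Sum>\<^sub>\<infinity>(x,y). f x * g y)"
    using infsum_Sigma'_banach[OF s] by (simp add: infsum_cmult_right' infsum_cmult_left')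
qed

lemma ramanujan_phi_mult:
  fixes q :: complex
  assumes "norm q < 1" and "k > 0" "l > 0"
  shows "(\<lambda>(x::int,y::int). q ^ nat (int k * x\<^sup>2 + int l * y\<^sup>2)) summable_on UNIV"
    and "ramanujan_phi (q ^ k) * ramanujan_phi (q ^ l) =
           (\<Sum>\<^sub>\<infinity>(x::int,y::int). q ^ nat (int k * x\<^sup>2 + int l * y\<^sup>2))"
proof -
  have abs_le: "\<bar>m\<bar> \<le> int j * m\<^sup>2" if "j > 0" for m :: int and j
  proof -
    have "\<bar>m\<bar> * 1 \<le> \<bar>m\<bar> * \<bar>m\<bar>" by (cases "m = 0") (simp_all add: mult_left_mono del: abs_mult_self_eq)
    also have "\<dots> = 1 * m\<^sup>2" by (simp add: power2_eq_square)
    also have "\<dots> \<le> int j * m\<^sup>2" using that by (intro mult_right_mono) auto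
    finally show ?thesis by simp
  qed
  have sm: "(\<lambda>m::int. norm (q ^ nat (int j * m\<^sup>2))) summable_on UNIV" if "j > 0" for j
    using abs_summable_on_power_int[of q "\<lambda>_. 1" "\<lambda>m. int j * m\<^sup>2"] abs_le[OF that] assms by simp
  have phi: "ramanujan_phi (q ^ j) = (\<Sum>\<^sub>\<infinity>m::int. q ^ nat (int j * m\<^sup>2))" for j
    unfolding ramanujan_phi_def
    by (rule infsum_cong) (simp add: power_int_def power_mult[symmetric] nat_mult_distrib)
  have eq: "(\<lambda>(x::int,y::int). q ^ nat (int k * x\<^sup>2) * q ^ nat (int l * y\<^sup>2)) =
            (\<lambda>(x,y). q ^ nat (int k * x\<^sup>2 + int l * y\<^sup>2))"
    by (auto simp: fun_eq_iff nat_add_distrib power_add)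
  show "(\<lambda>(x::int,y::int). q ^ nat (int k * x\<^sup>2 + int l * y\<^sup>2)) summable_on UNIV"
    using infsum_mult_abs_summable(1)[OF sm[OF assms(2)] sm[OF assms(3)]] unfolding eq .
  show "ramanujan_phi (q ^ k) * ramanujan_phi (q ^ l) =
           (\<Sum>\<^sub>\<infinity>(x::int,y::int). q ^ nat (int k * x\<^sup>2 + int l * y\<^sup>2))"
    using infsum_mult_abs_summable(2)[OF sm[OF assms(2)] sm[OF assms(3)]] unfolding eq phi .
qed

text \<open>Four times the exponent is (6m+1)^2 + 3(6n+1)^2: the leading factor q completes both
  squares, so the series can be compared with sums over x^2 + 3y^2.\<close>

lemma euler_E_mult:
  fixes q :: complex
  assumes q: "norm q < 1"
  shows "(\<lambda>(m::int,n::int). (-1) ^ nat \<bar>m + n\<bar> * q ^ nat (9*m\<^sup>2 + 3*m + 27*n\<^sup>2 + 9*n + 1)) summable_on UNIV"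
    and "q * euler_E (q ^ 6) * euler_E (q ^ 18) =
           (\<Sum>\<^sub>\<infinity>(m::int,n::int). (-1) ^ nat \<bar>m + n\<bar> * q ^ nat (9*m\<^sup>2 + 3*m + 27*n\<^sup>2 + 9*n + 1))"
proof -
  have ge: "\<bar>m\<bar> \<le> int j * (3*m\<^sup>2 + m)" if "j > 0" for m :: int and j
  proof -
    have "\<bar>m\<bar> * 1 \<le> \<bar>m\<bar> * \<bar>m\<bar>" by (cases "m = 0") (simp_all add: mult_left_mono del: abs_mult_self_eq)
    hence "\<bar>m\<bar> \<le> m\<^sup>2" by (simp add: power2_eq_square)
    hence "\<bar>m\<bar> \<le> 1 * (3*m\<^sup>2 + m)" by (cases "m \<ge> 0") auto
    also have "\<dots> \<le> int j * (3*m\<^sup>2 + m)" using that \<open>\<bar>m\<bar> \<le> m\<^sup>2\<close> by (intro mult_right_mono) auto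
    finally show ?thesis .
  qed
  \<comment> \<open>The argument q^(2j) absorbs the denominator 2 of the pentagonal numbers; j = 3
    and j = 9 give E(q^6) and E(q^18).\<close>
  define g where "g j m = (-1) ^ nat \<bar>m\<bar> * q ^ nat (int j * (3*m\<^sup>2 + m))" for j and m :: int
  have sm: "(\<lambda>x. norm (g j x)) summable_on UNIV" if "j > 0" for j
    unfolding g_def using ge[OF that] by (intro abs_summable_on_power_int q) (auto simp: norm_power)
  have E: "euler_E (q ^ (2*j)) = infsum (g j) UNIV" if "j > 0" for j
  proof -
    have "norm (q ^ (2*j)) < 1" using q that by (simp add: norm_power power_less_one_iff)
    from pentagonal_number_theorem[OF this] show ?thesis
    proof (rule trans, intro infsum_cong)
      fix m :: int
      have "even (m * (3*m+1))" by auto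
      then obtain t where t: "m * (3*m+1) = 2 * t" by (elim evenE)
      hence t': "3*m\<^sup>2 + m = 2 * t" by (simp add: power2_eq_square algebra_simps)
      hence "t \<ge> 0" using ge[of 1 m] by simp
      hence "nat (int j * (2 * t)) = 2 * j * nat t" by (simp add: nat_mult_distrib)
      thus "(-1) ^ nat \<bar>m\<bar> * (q ^ (2*j)) ^ nat (m * (3*m+1) div 2) = g j m"
        unfolding g_def t t' by (simp add: power_mult[symmetric])
    qed
  qed
  have eq: "q * (g 3 m * g 9 n) = (-1) ^ nat \<bar>m + n\<bar> * q ^ nat (9*m\<^sup>2 + 3*m + 27*n\<^sup>2 + 9*n + 1)" for m n
  proof -
    have sgn: "(-1::complex) ^ nat \<bar>m\<bar> * (-1) ^ nat \<bar>n\<bar> = (-1) ^ nat \<bar>m + n\<bar>"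
      by (cases "even m"; cases "even n") (simp_all add: even_nat_iff uminus_power_if)
    have "nat (9*m\<^sup>2 + 3*m + 27*n\<^sup>2 + 9*n + 1) = nat (1 + (int 3 * (3*m\<^sup>2 + m) + int 9 * (3*n\<^sup>2 + n)))"
      by (simp add: algebra_simps)
    also have "\<dots> = 1 + (nat (int 3 * (3*m\<^sup>2 + m)) + nat (int 9 * (3*n\<^sup>2 + n)))"
      using ge[of 3 m] ge[of 9 n] by (simp add: nat_add_distrib)
    finally show ?thesis unfolding g_def sgn[symmetric] by (simp add: power_add mult_ac)
  qed
  have sm2: "(\<lambda>(m,n). g 3 m * g 9 n) summable_on UNIV"
    and prod: "infsum (g 3) UNIV * infsum (g 9) UNIV = (\<Sum>\<^sub>\<infinity>(m,n). g 3 m * g 9 n)"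
    using infsum_mult_abs_summable[OF sm sm, of 3 9] by auto
  show "(\<lambda>(m::int,n::int). (-1) ^ nat \<bar>m + n\<bar> * q ^ nat (9*m\<^sup>2 + 3*m + 27*n\<^sup>2 + 9*n + 1)) summable_on UNIV"
    using summable_on_cmult_right[OF sm2, of q] unfolding case_prod_unfold eq .
  show "q * euler_E (q ^ 6) * euler_E (q ^ 18) =
           (\<Sum>\<^sub>\<infinity>(m::int,n::int). (-1) ^ nat \<bar>m + n\<bar> * q ^ nat (9*m\<^sup>2 + 3*m + 27*n\<^sup>2 + 9*n + 1))"
    using E[of 3] E[of 9] prod infsum_cmult_right'[of q "\<lambda>(m,n). g 3 m * g 9 n" UNIV]
    unfolding case_prod_unfold eq by (simp add: mult.assoc)
qed

section \<open>The theta identity\<close>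

text \<open>The four theta products are sums of one series over Z^2 and over its sublattices 3 | x,
  3 | y and both. Once \<open>rot\<close> and \<open>refl\<close> have removed the classes with x +
  y even, the claim is that q E(q^6) E(q^18) is half the difference of the sums over
  \<open>S 0 False\<close> and \<open>S 1 False\<close>.\<close>

lemma theta_identity:
  fixes q :: complex
  assumes q: "norm q < 1"
  shows "ramanujan_phi q * ramanujan_phi (q ^ 27) =
         (ramanujan_phi q * ramanujan_phi (q ^ 3) - ramanujan_phi (q ^ 3) * ramanujan_phi (q ^ 9)) / 3
         + ramanujan_phi (q ^ 9) * ramanujan_phi (q ^ 27)
         + 4 / 3 * q * euler_E (q ^ 6) * euler_E (q ^ 18)"
proof -
  define f where "f = (\<lambda>(x::int,y::int). q ^ nat (x\<^sup>2 + 3 * y\<^sup>2))"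
  define G where "G S = infsum f S" for S
  have sm: "f summable_on S" for S
    using ramanujan_phi_mult(1)[OF q, of 1 3] summable_on_subset_banach[of f UNIV S] by (simp add: f_def)
  have G_Un: "G (A \<union> B) = G A + G B" if "A \<inter> B = {}" for A B
    unfolding G_def by (rule infsum_Un_disjoint[OF sm sm that])
  have G_Un2: "G U = G A + G B" if "U = A \<union> B" "A \<inter> B = {}" for U A B
    using G_Un[OF that(2)] that(1) by simp
  have G_Un3: "G U = G A + (G B + G C)" if "U = A \<union> (B \<union> C)" "A \<inter> (B \<union> C) = {}" "B \<inter> C = {}" for U A B C
    using G_Un2[OF that(1,2)] G_Un[OF that(3)] by simp
  define X3 where "X3 = {z::int\<times>int. 3 dvd fst z}"
  define Y3 where "Y3 = {z::int\<times>int. 3 dvd snd z}"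
  \<comment> \<open>For x prime to 3, i is the residue of y/x modulo 3. The flag b separates the
    points that multiplication by omega maps to integer points (x + y even) from the others.\<close>
  define S where "S i b = {(x::int,y::int). \<not> 3 dvd x \<and> 3 dvd (y - i * x) \<and> (even (x + y) = b)}" for i b
  have phi: "ramanujan_phi q * ramanujan_phi (q ^ 3) = G UNIV"
    using ramanujan_phi_mult(2)[OF q, of 1 3] by (simp add: G_def f_def)
  have phi3: "ramanujan_phi (q ^ 9) * ramanujan_phi (q ^ 3) = G X3"
    using ramanujan_phi_mult(2)[OF q, of 9 3] unfolding G_def f_def X3_def
    by (simp, intro infsum_reindex_bij_witness[where i = "\<lambda>(x,y). (x div 3, y)" and j = "\<lambda>(x,y). (3*x,y)"])
       (auto simp: power_mult_distrib)
  have phi27: "ramanujan_phi q * ramanujan_phi (q ^ 27) = G Y3"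
    using ramanujan_phi_mult(2)[OF q, of 1 27] unfolding G_def f_def Y3_def
    by (simp, intro infsum_reindex_bij_witness[where i = "\<lambda>(x,y). (x, y div 3)" and j = "\<lambda>(x,y). (x,3*y)"])
       (auto simp: power_mult_distrib)
  have phi927: "ramanujan_phi (q ^ 9) * ramanujan_phi (q ^ 27) = G (X3 \<inter> Y3)"
    using ramanujan_phi_mult(2)[OF q, of 9 27] unfolding G_def f_def X3_def Y3_def
    by (simp, intro infsum_reindex_bij_witness[where i = "\<lambda>(x,y). (x div 3, y div 3)" and j = "\<lambda>(x,y). (3*x,3*y)"])
       (auto simp: power_mult_distrib)
  have Y3_eq: "G Y3 = G (X3 \<inter> Y3) + (G (S 0 True) + G (S 0 False))"
    by (rule G_Un3) (auto simp: X3_def Y3_def S_def)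
  have in_S: "(x, y) \<in> S i b \<longleftrightarrow> \<not> 3 dvd x \<and> 3 dvd (y - i * x) \<and> (even (x + y) = b)" for x y i b
    by (simp add: S_def)
  have in_S0: "(x, y) \<in> S 0 b \<longleftrightarrow> \<not> 3 dvd x \<and> 3 dvd y \<and> (even (x + y) = b)"
   and in_S1: "(x, y) \<in> S 1 b \<longleftrightarrow> \<not> 3 dvd x \<and> 3 dvd (y - x) \<and> (even (x + y) = b)"
   and in_S2: "(x, y) \<in> S (-1) b \<longleftrightarrow> \<not> 3 dvd x \<and> 3 dvd (y + x) \<and> (even (x + y) = b)" for x y b
    by (simp_all add: S_def)
  have S_disj: "S 0 b \<inter> (S 1 b \<union> S (-1) b) = {}" "S 1 b \<inter> S (-1) b = {}" for b
  proof -
    have "\<not> (\<not> 3 dvd x \<and> 3 dvd y \<and> 3 dvd (y - x))" "\<not> (\<not> 3 dvd x \<and> 3 dvd y \<and> 3 dvd (y + x))"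
         "\<not> (\<not> 3 dvd x \<and> 3 dvd (y - x) \<and> 3 dvd (y + x))" for x y :: int
      by presburger+
    hence "\<not> ((x, y) \<in> S 0 b \<and> (x, y) \<in> S 1 b)" "\<not> ((x, y) \<in> S 0 b \<and> (x, y) \<in> S (-1) b)"
         "\<not> ((x, y) \<in> S 1 b \<and> (x, y) \<in> S (-1) b)" for x y
      unfolding in_S0 in_S1 in_S2 by metis+
    thus "S 0 b \<inter> (S 1 b \<union> S (-1) b) = {}" "S 1 b \<inter> S (-1) b = {}" by auto
  qed
  have S_cover: "(x, y) \<in> S 0 b \<union> (S 1 b \<union> S (-1) b) \<longleftrightarrow> \<not> 3 dvd x \<and> (even (x + y) = b)" for x y b
  proof -
    have "3 dvd y \<or> 3 dvd (y - x) \<or> 3 dvd (y + x)" if "\<not> 3 dvd x" using that by presburger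
    thus ?thesis unfolding Un_iff in_S0 in_S1 in_S2 by metis
  qed
  have S_all: "G {z::int\<times>int. \<not> 3 dvd fst z \<and> even (fst z + snd z) = b} = G (S 0 b) + (G (S 1 b) + G (S (-1) b))" for b
  proof (rule G_Un3[OF _ S_disj])
    show "{z::int\<times>int. \<not> 3 dvd fst z \<and> even (fst z + snd z) = b} = S 0 b \<union> (S 1 b \<union> S (-1) b)"
    proof (rule Set.set_eqI)
      fix z :: "int \<times> int"
      show "z \<in> {z. \<not> 3 dvd fst z \<and> even (fst z + snd z) = b} \<longleftrightarrow> z \<in> S 0 b \<union> (S 1 b \<union> S (-1) b)"
        by (cases z) (simp only: S_cover mem_Collect_eq fst_conv snd_conv)
    qed
  qed
  have UNIV_eq: "G UNIV = G X3 + ((G (S 0 True) + (G (S 1 True) + G (S (-1) True))) +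
                                  (G (S 0 False) + (G (S 1 False) + G (S (-1) False))))"
    unfolding S_all[symmetric] by (rule G_Un3) (auto simp: X3_def)
  have refl: "G (S (-1) b) = G (S 1 b)" for b
    unfolding G_def f_def
    by (rule infsum_reindex_bij_witness[where i = "\<lambda>(x,y). (x,-y)" and j = "\<lambda>(x,y). (x,-y)"])
       (auto simp: in_S1 in_S2; presburger)+
  (* multiplication by a primitive cube root of unity on x + y sqrt(-3) *)
  have rot: "G (S 1 True) = G (S 0 True)"
    unfolding G_def
  proof (rule infsum_reindex_bij_witness[where j = "\<lambda>(x,y). ((- x - 3*y) div 2, (x - y) div 2)"
                                           and i = "\<lambda>(x,y). ((- x + 3*y) div 2, (- x - y) div 2)"])
    fix z :: "int \<times> int" assume z: "z \<in> S 1 True"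
    obtain x y where xy: "z = (x, y)" by force
    from z have "even (y - x)" unfolding xy in_S by simp
    then obtain k where "y - x = 2 * k" by (elim evenE)
    hence k: "y = x + 2 * k" by simp
    have j: "(- x - 3*y) div 2 = - 2 * x - 3 * k" "(x - y) div 2 = - k" unfolding k by simp_all
    show "(case (case z of (x,y) \<Rightarrow> ((- x - 3*y) div 2, (x - y) div 2)) of
            (x,y) \<Rightarrow> ((- x + 3*y) div 2, (- x - y) div 2)) = z"
      unfolding xy prod.case j prod.inject using k by presburger
    show "(case z of (x,y) \<Rightarrow> ((- x - 3*y) div 2, (x - y) div 2)) \<in> S 0 True"
      using z unfolding xy prod.case j in_S0 in_S1 in_S2 unfolding k by presburger
    show "f (case z of (x,y) \<Rightarrow> ((- x - 3*y) div 2, (x - y) div 2)) = f z"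
      unfolding xy prod.case j f_def unfolding k
      by (rule arg_cong[where f = "\<lambda>e. q ^ nat e"]) (simp add: power2_eq_square algebra_simps)
  next
    fix z :: "int \<times> int" assume z: "z \<in> S 0 True"
    obtain x y where xy: "z = (x, y)" by force
    from z have "even (x - y)" unfolding xy in_S by simp
    then obtain k where "x - y = 2 * k" by (elim evenE)
    hence k: "x = y + 2 * k" by simp
    have j: "(- x + 3*y) div 2 = y - k" "(- x - y) div 2 = - y - k" unfolding k by simp_all
    show "(case (case z of (x,y) \<Rightarrow> ((- x + 3*y) div 2, (- x - y) div 2)) of
            (x,y) \<Rightarrow> ((- x - 3*y) div 2, (x - y) div 2)) = z"
      unfolding xy prod.case j prod.inject using k by presburger
    show "(case z of (x,y) \<Rightarrow> ((- x + 3*y) div 2, (- x - y) div 2)) \<in> S 1 True"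
      using z unfolding xy prod.case j in_S0 in_S1 in_S2 unfolding k by presburger
  qed
  have dvd6: "6 dvd t" if "2 dvd t" "3 dvd t" for t :: int
    using that by presburger
  define H where "H = (\<lambda>(m::int,n::int). (-1) ^ nat \<bar>m + n\<bar> * q ^ nat (9*m\<^sup>2 + 3*m + 27*n\<^sup>2 + 9*n + 1))"
  have smH: "H summable_on A" for A
    using euler_E_mult(1)[OF q] summable_on_subset_banach[of H UNIV A] by (simp add: H_def)
  have neg_S: "(-x, -y) \<in> S i False" if "(x, y) \<in> S i False" for x y i
  proof -
    have eq: "- y - i * (- x) = - (y - i * x)" "- x + - y = - (x + y)" by simp_all
    from that show ?thesis unfolding in_S eq dvd_minus_iff .
  qed
  have neg_cong: "3 dvd (- x - 1) \<longleftrightarrow> 3 dvd (x - 2)" "3 dvd (- x - 2) \<longleftrightarrow> 3 dvd (x - 1)" for x :: int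
    by presburger+
  \<comment> \<open>Negation exchanges x congruent to 1 and to 2 mod 3. The double series reaches
    only the first kind, hence the factor 2.\<close>
  have half: "G (S i False) = 2 * G {z \<in> S i False. 3 dvd (fst z - 1)}" for i
  proof -
    have "3 dvd (fst z - 1) \<or> 3 dvd (fst z - 2)" if "z \<in> S i False" for z
    proof -
      have "\<not> 3 dvd fst z" using that by (cases z) (simp add: in_S)
      thus ?thesis by presburger
    qed
    hence un: "S i False = {z \<in> S i False. 3 dvd (fst z - 1)} \<union> {z \<in> S i False. 3 dvd (fst z - 2)}"
      by blast
    have "\<not> (3 dvd (x - 1) \<and> 3 dvd (x - 2))" for x :: int by presburger
    hence dj: "{z \<in> S i False. 3 dvd (fst z - 1)} \<inter> {z \<in> S i False. 3 dvd (fst z - 2)} = {}"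
      by blast
    have ng: "G {z \<in> S i False. 3 dvd (fst z - 2)} = G {z \<in> S i False. 3 dvd (fst z - 1)}"
      unfolding G_def f_def
    proof (rule infsum_reindex_bij_witness[where i = "\<lambda>(x,y). (-x,-y)" and j = "\<lambda>(x,y). (-x,-y)"])
      show "(case z of (x,y) \<Rightarrow> (-x,-y)) \<in> {z \<in> S i False. 3 dvd (fst z - 1)}"
        if "z \<in> {z \<in> S i False. 3 dvd (fst z - 2)}" for z
        using that by (cases z) (simp add: neg_S neg_cong del: minus_diff_eq)
      show "(case z of (x,y) \<Rightarrow> (-x,-y)) \<in> {z \<in> S i False. 3 dvd (fst z - 2)}"
        if "z \<in> {z \<in> S i False. 3 dvd (fst z - 1)}" for z
        using that by (cases z) (simp add: neg_S neg_cong del: minus_diff_eq)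
    qed (simp_all add: split_beta)
    show ?thesis using G_Un2[OF un dj] ng by simp
  qed
  \<comment> \<open>Writing points as x + y sqrt(-3), the image is the conjugate of ((6m+1) + (6n+1)
    sqrt(-3))/2 times the unit (1 - sqrt(-3))/2; it is integral because m + n is even.\<close>
  have even_part: "infsum H {z. even (fst z + snd z)} = G {z \<in> S 0 False. 3 dvd (fst z - 1)}"
    unfolding G_def
  proof (rule infsum_reindex_bij_witness[where j = "\<lambda>(m,n). ((3*m+9*n+2) div 2, 3 * ((m - n) div 2))"
                and i = "\<lambda>(x,y). ((x - 1 - y) div 6 + 2 * (y div 3), (x - 1 - y) div 6)"])
    fix z :: "int \<times> int" assume z: "z \<in> {z. even (fst z + snd z)}"
    obtain m n where mn: "z = (m, n)" by force
    from z have "even (m - n)" unfolding mn by simp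
    then obtain k where "m - n = 2 * k" by (elim evenE)
    hence k: "m = n + 2 * k" by simp
    have j: "(3*m+9*n+2) div 2 = 6*n + 3*k + 1" "(m - n) div 2 = k" unfolding k by simp_all
    have r: "(6*n+3*k+1 - 1 - 3*k) div 6 = n" "3*k div 3 = k" by simp_all
    show "(case (case z of (m,n) \<Rightarrow> ((3*m+9*n+2) div 2, 3 * ((m - n) div 2))) of
           (x,y) \<Rightarrow> ((x - 1 - y) div 6 + 2 * (y div 3), (x - 1 - y) div 6)) = z"
      unfolding mn prod.case j r using k by simp
    show "(case z of (m,n) \<Rightarrow> ((3*m+9*n+2) div 2, 3 * ((m - n) div 2))) \<in> {z \<in> S 0 False. 3 dvd (fst z - 1)}"
      unfolding mn prod.case j mem_Collect_eq in_S0 in_S2 fst_conv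
      by (intro conjI; presburger)
    have "even (nat \<bar>m + n\<bar>)" using k by (simp add: even_nat_iff)
    thus "f (case z of (m,n) \<Rightarrow> ((3*m+9*n+2) div 2, 3 * ((m - n) div 2))) = H z"
      unfolding mn prod.case j f_def H_def unfolding k
      by (simp add: power2_eq_square algebra_simps)
  next
    fix z :: "int \<times> int" assume z: "z \<in> {z \<in> S 0 False. 3 dvd (fst z - 1)}"
    obtain x y where xy: "z = (x, y)" by force
    from z obtain k where k: "y = 3 * k" by (auto simp: xy in_S)
    from z have "3 dvd y" "odd (x + y)" "3 dvd (x - 1)" unfolding xy by (auto simp: in_S0)
    hence "6 dvd (x - 1 - y)" by (intro dvd6) presburger+
    then obtain n where "x - 1 - y = 6 * n" by (elim dvdE)
    hence n: "x = 1 + y + 6 * n" by simp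
    have i: "(x - 1 - y) div 6 = n" "y div 3 = k" unfolding n k by simp_all
    have r: "(3*(n+2*k)+9*n+2) div 2 = 6*n+3*k+1" "(n+2*k-n) div 2 = k" by simp_all
    show "(case (case z of (x,y) \<Rightarrow> ((x - 1 - y) div 6 + 2 * (y div 3), (x - 1 - y) div 6)) of
            (m,n) \<Rightarrow> ((3*m+9*n+2) div 2, 3 * ((m - n) div 2))) = z"
      unfolding xy prod.case i r using n k by simp
    show "(case z of (x,y) \<Rightarrow> ((x - 1 - y) div 6 + 2 * (y div 3), (x - 1 - y) div 6)) \<in> {z. even (fst z + snd z)}"
      unfolding xy prod.case i by simp
  qed
  \<comment> \<open>Here the unit is (1 + sqrt(-3))/2, without conjugation. The sign (-1)^(m+n)
    makes this class enter negatively.\<close>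
  have odd_part: "infsum H {z. odd (fst z + snd z)} = - G {z \<in> S (-1) False. 3 dvd (fst z - 1)}"
    unfolding G_def infsum_uminus[symmetric]
  proof (rule infsum_reindex_bij_witness[where j = "\<lambda>(m,n). ((3*m-9*n-1) div 2, (3*(m+n)+1) div 2)"
                and i = "\<lambda>(x,y). ((2*y-1) div 3 - (y-x-1) div 6, (y-x-1) div 6)"])
    fix z :: "int \<times> int" assume z: "z \<in> {z. odd (fst z + snd z)}"
    obtain m n where mn: "z = (m, n)" by force
    from z have "odd (m + n)" unfolding mn by simp
    then obtain k where "m + n = 2 * k + 1" by (elim oddE)
    hence k: "m = 2 * k + 1 - n" by simp
    have j: "(3*m-9*n-1) div 2 = 3 * k + 1 - 6 * n" "(3*(m+n)+1) div 2 = 3 * k + 2" unfolding k by simp_all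
    have r: "(3*k+2 - (3*k+1-6*n) - 1) div 6 = n" "(2*(3*k+2)-1) div 3 = 2*k+1" by simp_all
    show "(case (case z of (m,n) \<Rightarrow> ((3*m-9*n-1) div 2, (3*(m+n)+1) div 2)) of
           (x,y) \<Rightarrow> ((2*y-1) div 3 - (y-x-1) div 6, (y-x-1) div 6)) = z"
      unfolding mn prod.case j r using k by simp
    show "(case z of (m,n) \<Rightarrow> ((3*m-9*n-1) div 2, (3*(m+n)+1) div 2)) \<in> {z \<in> S (-1) False. 3 dvd (fst z - 1)}"
      unfolding mn prod.case j mem_Collect_eq in_S0 in_S2 fst_conv
      by (intro conjI; presburger)
    have "odd (nat \<bar>m + n\<bar>)" using k by (simp add: even_nat_iff)
    thus "- f (case z of (m,n) \<Rightarrow> ((3*m-9*n-1) div 2, (3*(m+n)+1) div 2)) = H z"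
      unfolding mn prod.case j f_def H_def unfolding k
      by (simp add: power2_eq_square algebra_simps)
  next
    fix z :: "int \<times> int" assume z: "z \<in> {z \<in> S (-1) False. 3 dvd (fst z - 1)}"
    obtain x y where xy: "z = (x, y)" by force
    from z have S: "3 dvd (y + x)" "odd (x + y)" "3 dvd (x - 1)" unfolding xy by (auto simp: in_S2)
    hence "3 dvd (y - 2)" by presburger
    then obtain k where "y - 2 = 3 * k" by (elim dvdE)
    hence k: "y = 2 + 3 * k" by simp
    from S have "6 dvd (y - x - 1)" by (intro dvd6) presburger+
    then obtain n where "y - x - 1 = 6 * n" by (elim dvdE)
    hence n: "x = y - 1 - 6 * n" by simp
    have i: "(y - x - 1) div 6 = n" "(2*y - 1) div 3 = 2*k+1" unfolding n k by simp_all
    have r: "(3*(2*k+1-n) - 9*n - 1) div 2 = 3*k+1-6*n" "(3*(2*k+1-n+n)+1) div 2 = 3*k+2" by simp_all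
    show "(case (case z of (x,y) \<Rightarrow> ((2*y-1) div 3 - (y-x-1) div 6, (y-x-1) div 6)) of
            (m,n) \<Rightarrow> ((3*m-9*n-1) div 2, (3*(m+n)+1) div 2)) = z"
      unfolding xy prod.case i r using n k by simp
    show "(case z of (x,y) \<Rightarrow> ((2*y-1) div 3 - (y-x-1) div 6, (y-x-1) div 6)) \<in> {z. odd (fst z + snd z)}"
      unfolding xy prod.case i by simp
  qed
  have "q * euler_E (q ^ 6) * euler_E (q ^ 18) = infsum H UNIV"
    using euler_E_mult(2)[OF q] by (simp add: H_def)
  also have "UNIV = {z::int\<times>int. even (fst z + snd z)} \<union> {z. odd (fst z + snd z)}" by auto
  also have "infsum H \<dots> = infsum H {z. even (fst z + snd z)} + infsum H {z. odd (fst z + snd z)}"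
    by (rule infsum_Un_disjoint[OF smH smH]) auto
  also have "\<dots> = (G (S 0 False) - G (S 1 False)) / 2"
    unfolding even_part odd_part using half[of 0] half[of "-1"] refl[of False] by (simp add: field_simps)
  finally have "q * euler_E (q ^ 6) * euler_E (q ^ 18) = (G (S 0 False) - G (S 1 False)) / 2" .
  hence "4 / 3 * (q * euler_E (q ^ 6) * euler_E (q ^ 18)) = 2 / 3 * (G (S 0 False) - G (S 1 False))"
    by (simp only:) simp
  hence "4 / 3 * q * euler_E (q ^ 6) * euler_E (q ^ 18) = 2 / 3 * (G (S 0 False) - G (S 1 False))"
    by (simp only: mult.assoc)
  moreover have "ramanujan_phi (q ^ 3) * ramanujan_phi (q ^ 9) = G X3" using phi3 by (simp add: mult.commute)
  ultimately show ?thesis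
    unfolding phi phi27 phi927 Y3_eq UNIV_eq refl rot by (simp add: field_simps)
qed

section \<open>Jacobi sums of cubic characters\<close>

definition omega :: complex where "omega = Complex (-1/2) (sqrt 3 / 2)"

lemma omega_sq: "omega\<^sup>2 = - 1 - omega"
  by (simp add: omega_def complex_eq_iff power2_eq_square)

lemma omega_cube: "omega ^ 3 = 1"
proof -
  have "omega ^ 3 = omega * omega\<^sup>2" by (simp add: power3_eq_cube power2_eq_square)
  also have "\<dots> = omega * (- 1 - omega)" by (simp only: omega_sq)
  also have "\<dots> = - omega - omega\<^sup>2" by (simp add: right_diff_distrib power2_eq_square)
  finally show ?thesis by (simp add: omega_sq)
qed

lemma cnj_omega: "cnj omega = omega\<^sup>2"
  by (simp add: omega_def complex_eq_iff power2_eq_square)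

lemma omega_neq_1: "omega \<noteq> 1"
  by (simp add: omega_def complex_eq_iff)

text \<open>A subset of the complex numbers instead of a separate type, so that character values and
  their conjugates can be summed without an embedding.\<close>

definition eisenstein :: "complex set" where
  "eisenstein = {of_int a + of_int b * omega |a b. True}"

lemma eisensteinI: "of_int a + of_int b * omega \<in> eisenstein"
  by (auto simp: eisenstein_def)

lemma eisenstein_1: "1 \<in> eisenstein" and eisenstein_0: "0 \<in> eisenstein"
  and eisenstein_omega: "omega \<in> eisenstein"
  using eisensteinI[of 1 0] eisensteinI[of 0 0] eisensteinI[of 0 1] by simp_all

lemma eisenstein_add: "x \<in> eisenstein \<Longrightarrow> y \<in> eisenstein \<Longrightarrow> x + y \<in> eisenstein"
proof -
  assume "x \<in> eisenstein" "y \<in> eisenstein"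
  then obtain a b c d where "x = of_int a + of_int b * omega" "y = of_int c + of_int d * omega"
    by (auto simp: eisenstein_def)
  hence "x + y = of_int (a + c) + of_int (b + d) * omega" by (simp add: algebra_simps)
  thus ?thesis by (simp only: eisensteinI)
qed

lemma eisenstein_mult: "x \<in> eisenstein \<Longrightarrow> y \<in> eisenstein \<Longrightarrow> x * y \<in> eisenstein"
proof -
  assume "x \<in> eisenstein" "y \<in> eisenstein"
  then obtain a b c d where xy: "x = of_int a + of_int b * omega" "y = of_int c + of_int d * omega"
    by (auto simp: eisenstein_def)
  have "x * y = of_int (a * c) + of_int (a * d + b * c) * omega + of_int (b * d) * omega\<^sup>2"
    unfolding xy by (simp add: algebra_simps power2_eq_square)
  also have "\<dots> = of_int (a * c - b * d) + of_int (a * d + b * c - b * d) * omega"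
    unfolding omega_sq by (simp add: algebra_simps)
  finally show ?thesis by (simp only: eisensteinI)
qed

lemma eisenstein_sum: "(\<And>x. x \<in> A \<Longrightarrow> f x \<in> eisenstein) \<Longrightarrow> sum f A \<in> eisenstein"
  by (induction A rule: infinite_finite_induct) (auto simp: eisenstein_0 eisenstein_add)

lemma eisenstein_coeffs_unique:
  assumes "of_int a + of_int b * omega = of_int c + of_int d * omega"
  shows "a = c" "b = d"
proof -
  have "b = d" using arg_cong[OF assms, of Im] by (simp add: omega_def)
  moreover have "a = c" using arg_cong[OF assms, of Re] \<open>b = d\<close> by (simp add: omega_def)
  ultimately show "a = c" "b = d" by auto
qed

lemma eisenstein_norm:
  "(of_int a + of_int b * omega) * cnj (of_int a + of_int b * omega) = of_int (a\<^sup>2 - a * b + b\<^sup>2)"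
proof -
  have "(of_int a + of_int b * omega) * cnj (of_int a + of_int b * omega) =
        of_int (a\<^sup>2) + of_int (a * b) * (omega + omega\<^sup>2) + of_int (b\<^sup>2) * omega ^ 3"
    by (simp add: cnj_omega algebra_simps power2_eq_square power3_eq_cube)
  thus ?thesis by (simp add: omega_sq omega_cube)
qed

lemma sum_residues_shift:
  fixes f :: "int \<Rightarrow> 'a :: comm_monoid_add"
  assumes "p > 0" and "\<And>x. f (x mod p) = f x"
  shows "(\<Sum>x\<in>{0..<p}. f (x + c)) = (\<Sum>x\<in>{0..<p}. f x)"
proof (rule sum.reindex_bij_witness[of _ "\<lambda>y. (y - c) mod p" "\<lambda>x. (x + c) mod p"])
  show "((a + c) mod p - c) mod p = a" if "a \<in> {0..<p}" for a
    using that by (simp add: mod_diff_left_eq)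
  show "((a - c) mod p + c) mod p = a" if "a \<in> {0..<p}" for a
    using that by (simp add: mod_add_left_eq)
qed (use assms in auto)

lemma sum_residues_scale:
  fixes f :: "int \<Rightarrow> 'a :: comm_monoid_add"
  assumes "p > 0" "coprime c p" and "\<And>x. f (x mod p) = f x"
  shows "(\<Sum>x\<in>{0..<p}. f (c * x)) = (\<Sum>x\<in>{0..<p}. f x)"
proof -
  obtain d where "[c * d = 1] (mod p)" using assms(2) cong_solve_coprime_int by blast
  hence cd: "[c * d * a = a] (mod p)" for a by (metis cong_scalar_right mult_1)
  show ?thesis
  proof (rule sum.reindex_bij_witness[of _ "\<lambda>y. (d * y) mod p" "\<lambda>x. (c * x) mod p"])
    fix a assume a: "a \<in> {0..<p}"
    have "d * ((c * a) mod p) mod p = (c * d * a) mod p" "c * ((d * a) mod p) mod p = (c * d * a) mod p"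
      by (simp_all add: mod_mult_right_eq mult_ac)
    moreover have "(c * d * a) mod p = a" using cd[of a] a by (simp add: cong_def)
    ultimately show "d * ((c * a) mod p) mod p = a" "c * ((d * a) mod p) mod p = a" by auto
  qed (use assms in auto)
qed

section \<open>A cubic character and its Jacobi sum\<close>

text \<open>A Dirichlet character as a periodic function on the integers. The value 0 on multiples
  of p lets every sum run over a full residue system, which is stable under translation as well as
  dilation.\<close>

locale cubic_character =
  fixes p :: int and ch :: "int \<Rightarrow> complex"
  assumes prime_p: "prime p"
    and periodic: "ch (x mod p) = ch x"
    and mult: "ch (x * y) = ch x * ch y"
    and eq_0_iff: "ch x = 0 \<longleftrightarrow> p dvd x"
    and cube: "\<not> p dvd x \<Longrightarrow> ch x \<in> {1, omega, omega\<^sup>2}"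
    and nontrivial: "\<exists>x. \<not> p dvd x \<and> ch x \<noteq> 1"
begin

lemma p_gt_1: "p > 1"
  using prime_p by (rule prime_gt_1_int)

lemma coprime_p: "\<not> p dvd x \<Longrightarrow> coprime x p"
  using prime_p by (simp add: prime_imp_coprime coprime_commute)

lemma zero [simp]: "ch 0 = 0"
  by (simp add: eq_0_iff)

lemma one [simp]: "ch 1 = 1"
proof -
  have "ch 1 * ch 1 = ch 1" by (metis mult mult_1)
  moreover have "ch 1 \<noteq> 0" using prime_p not_prime_unit[of p] by (auto simp: eq_0_iff)
  ultimately show ?thesis by simp
qed

lemma cong: "[x = y] (mod p) \<Longrightarrow> ch x = ch y"
  by (metis cong_def periodic)

lemma norm_sq: "\<not> p dvd x \<Longrightarrow> ch x * cnj (ch x) = 1"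
proof -
  have "omega * omega\<^sup>2 = 1" using omega_cube by (simp add: eval_nat_numeral)
  moreover have "cnj (omega\<^sup>2) = omega" using cnj_omega by (metis complex_cnj_cnj)
  ultimately show "\<not> p dvd x \<Longrightarrow> ch x * cnj (ch x) = 1"
    using cube[of x] cnj_omega by (auto simp: mult.commute)
qed

lemma power_3: "\<not> p dvd x \<Longrightarrow> ch x ^ 3 = 1"
proof -
  have "(omega\<^sup>2) ^ 3 = (omega ^ 3)\<^sup>2" by (simp only: power_mult[symmetric] mult.commute)
  thus "\<not> p dvd x \<Longrightarrow> ch x ^ 3 = 1" using cube[of x] omega_cube by auto
qed

text \<open>Squaring a cube root of unity inverts it, and inversion is conjugation; on multiples of
  p both sides are 0.\<close>

lemma square: "ch x ^ 2 = cnj (ch x)"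
proof (cases "p dvd x")
  case True
  thus ?thesis using eq_0_iff[of x] by simp
next
  case False
  have "ch x * ch x ^ 2 = ch x * cnj (ch x)"
    using norm_sq[OF False] power_3[OF False] by (simp add: eval_nat_numeral)
  thus ?thesis using eq_0_iff[of x] False by simp
qed

lemma in_eisenstein: "ch x \<in> eisenstein"
  using cube[of x] eq_0_iff[of x] eisenstein_0 eisenstein_1 eisenstein_omega
    eisenstein_mult[OF eisenstein_omega eisenstein_omega]
  by (cases "p dvd x") (auto simp: power2_eq_square)

lemma sum_eq_0: "(\<Sum>x\<in>{0..<p}. ch x) = 0"
proof -
  obtain c where c: "\<not> p dvd c" "ch c \<noteq> 1" using nontrivial by blast
  have "ch c * (\<Sum>x\<in>{0..<p}. ch x) = (\<Sum>x\<in>{0..<p}. ch (c * x))"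
    by (simp add: mult sum_distrib_left)
  also have "\<dots> = (\<Sum>x\<in>{0..<p}. ch x)"
    using p_gt_1 coprime_p[OF c(1)] by (intro sum_residues_scale) (auto simp: periodic)
  finally show ?thesis using c(2) by simp
qed

lemma sum_cnj_eq_0: "(\<Sum>x\<in>{0..<p}. cnj (ch x)) = 0"
  using sum_eq_0 by (metis cnj_sum complex_cnj_zero)

lemma not_dvd_residue: "x \<in> {1..<p} \<Longrightarrow> \<not> p dvd x"
  using zdvd_not_zless by auto

lemma sum_split_0: "(\<Sum>x\<in>{0..<p}. f x) = f 0 + (\<Sum>x\<in>{1..<p}. f x)" for f :: "int \<Rightarrow> complex"
proof -
  have "{0..<p} = insert 0 {1..<p}" using p_gt_1 by auto
  thus ?thesis by simp
qed

lemma sum_split_0_1: "(\<Sum>x\<in>{0..<p}. f x) = f 0 + f 1 + (\<Sum>x\<in>{2..<p}. f x)" for f :: "int \<Rightarrow> complex"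
proof -
  have "{0..<p} = insert 0 (insert 1 {2..<p})" using p_gt_1 by auto
  thus ?thesis by (simp add: add.assoc)
qed

lemma sum_norm_sq: "(\<Sum>x\<in>{0..<p}. ch x * cnj (ch x)) = of_int (p - 1)"
proof -
  have "(\<Sum>x\<in>{1..<p}. ch x * cnj (ch x)) = (\<Sum>x\<in>{1..<p}. 1)"
    using not_dvd_residue norm_sq by (intro sum.cong) auto
  thus ?thesis using p_gt_1 by (simp add: sum_split_0)
qed

text \<open>Dilation by d shows that all shifts prime to p give the same value. The values for all d
  add up to 0 and the one at d = 0 is p - 1, so the common value is -1.\<close>

lemma correlation:
  "(\<Sum>u\<in>{0..<p}. ch u * cnj (ch (u + d))) = (if p dvd d then of_int p else 0) - 1"
proof -
  define K where "K d = (\<Sum>u\<in>{0..<p}. ch u * cnj (ch (u + d)))" for d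
  have K0: "K d = of_int (p - 1)" if "p dvd d" for d
  proof -
    have "ch (u + d) = ch u" for u using that by (intro cong) (simp add: cong_iff_dvd_diff)
    thus ?thesis unfolding K_def using sum_norm_sq by simp
  qed
  have K1: "K d = K 1" if "\<not> p dvd d" for d
  proof -
    have per: "ch (x mod p) * cnj (ch (x mod p + d)) = ch x * cnj (ch (x + d))" for x
    proof -
      have "ch (x mod p + d) = ch (x + d)" by (intro cong) (simp add: cong_def mod_add_left_eq)
      thus ?thesis by (simp add: periodic)
    qed
    have "K d = (\<Sum>u\<in>{0..<p}. ch (d * u) * cnj (ch (d * u + d)))"
      unfolding K_def
      by (rule sum_residues_scale[symmetric, where f = "\<lambda>u. ch u * cnj (ch (u + d))"])
         (use p_gt_1 coprime_p[OF that] per in auto)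
    also have "\<dots> = (\<Sum>u\<in>{0..<p}. (ch d * cnj (ch d)) * (ch u * cnj (ch (u + 1))))"
    proof (intro sum.cong refl)
      fix u
      have "ch (d * u + d) = ch d * ch (u + 1)" by (simp add: mult[symmetric] distrib_left)
      thus "ch (d * u) * cnj (ch (d * u + d)) = (ch d * cnj (ch d)) * (ch u * cnj (ch (u + 1)))"
        by (simp add: mult mult_ac)
    qed
    also have "\<dots> = K 1" unfolding K_def by (simp add: norm_sq[OF that])
    finally show ?thesis .
  qed
  have "(\<Sum>d\<in>{0..<p}. K d) = (\<Sum>u\<in>{0..<p}. ch u * (\<Sum>d\<in>{0..<p}. cnj (ch (d + u))))"
    unfolding K_def sum_distrib_left by (subst sum.swap) (simp add: add.commute)
  also have "\<dots> = 0"
  proof (rule sum.neutral, intro ballI)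
    fix u
    have "(\<Sum>d\<in>{0..<p}. cnj (ch (d + u))) = (\<Sum>d\<in>{0..<p}. cnj (ch d))"
      using p_gt_1 by (intro sum_residues_shift) (auto simp: periodic)
    thus "ch u * (\<Sum>d\<in>{0..<p}. cnj (ch (d + u))) = 0" by (simp add: sum_cnj_eq_0)
  qed
  finally have "K 0 + (\<Sum>d\<in>{1..<p}. K d) = 0" by (simp add: sum_split_0)
  moreover have "(\<Sum>d\<in>{1..<p}. K d) = (\<Sum>d\<in>{1..<p}. K 1)"
    by (intro sum.cong refl K1 not_dvd_residue)
  ultimately have "of_int (p - 1) + of_int (p - 1) * K 1 = 0"
    using K0[of 0] p_gt_1 by (simp add: of_nat_nat)
  hence "of_int (p - 1) * (1 + K 1) = 0" by (simp add: distrib_left)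
  moreover have "(of_int (p - 1) :: complex) \<noteq> 0" using p_gt_1 by (simp only: of_int_eq_0_iff)
  ultimately have "1 + K 1 = 0" by (metis mult_eq_0_iff)
  hence "K 1 = -1" by (simp add: add_eq_0_iff)
  hence "K d = (if p dvd d then of_int p else 0) - 1" using K0[of d] K1[of d] by auto
  thus ?thesis by (simp add: K_def)
qed

definition J :: complex where "J = (\<Sum>t\<in>{0..<p}. ch t * ch (1 - t))"

(* Both sides of the norm identity arise from the sum of |J(c)|^2 over all residues c,
   where J(c) = (sum over t) chi(t) chi(c - t) equals chi(c)^2 J. *)
lemma J_norm: "J * cnj J = of_int p"
proof -
  define Jc where "Jc c = (\<Sum>t\<in>{0..<p}. ch t * ch (c - t))" for c
  have Jc: "Jc c = ch c ^ 2 * J" if "\<not> p dvd c" for c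
  proof -
    have per: "ch (x mod p) * ch (c - x mod p) = ch x * ch (c - x)" for x
    proof -
      have "ch (c - x mod p) = ch (c - x)" by (intro cong) (simp add: cong_def mod_diff_right_eq)
      thus ?thesis by (simp add: periodic)
    qed
    have "Jc c = (\<Sum>t\<in>{0..<p}. ch (c * t) * ch (c - c * t))"
      unfolding Jc_def
      by (rule sum_residues_scale[symmetric, where f = "\<lambda>u. ch u * ch (c - u)"])
         (use p_gt_1 coprime_p[OF that] per in auto)
    also have "\<dots> = (\<Sum>t\<in>{0..<p}. ch c ^ 2 * (ch t * ch (1 - t)))"
    proof (intro sum.cong refl)
      fix t
      have "ch (c - c * t) = ch c * ch (1 - t)" by (simp add: mult[symmetric] right_diff_distrib)
      thus "ch (c * t) * ch (c - c * t) = ch c ^ 2 * (ch t * ch (1 - t))"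
        by (simp add: mult power2_eq_square mult_ac)
    qed
    finally show ?thesis by (simp add: J_def sum_distrib_left)
  qed
  \<comment> \<open>Up to chi(-1) this is the sum of chi(t)^2, hence of the conjugates of chi(t),
    which vanishes.\<close>
  have Jc0: "Jc 0 = 0"
  proof -
    have "ch (0 - t) = ch (- 1) * ch t" for t by (simp add: mult[symmetric])
    hence "Jc 0 = ch (-1) * (\<Sum>t\<in>{0..<p}. ch t ^ 2)"
      unfolding Jc_def by (simp only: sum_distrib_left power2_eq_square mult_ac)
    thus ?thesis by (simp add: square sum_cnj_eq_0)
  qed
  have "(\<Sum>c\<in>{0..<p}. Jc c * cnj (Jc c)) = (\<Sum>c\<in>{1..<p}. Jc c * cnj (Jc c))"
    by (simp add: sum_split_0 Jc0)
  also have "\<dots> = (\<Sum>c\<in>{1..<p}. J * cnj J)"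
  proof (intro sum.cong refl)
    fix c assume "c \<in> {1..<p}"
    hence c: "\<not> p dvd c" by (rule not_dvd_residue)
    have "Jc c * cnj (Jc c) = (ch c * cnj (ch c))\<^sup>2 * (J * cnj J)"
      by (simp add: Jc[OF c] power_mult_distrib mult_ac)
    thus "Jc c * cnj (Jc c) = J * cnj J" by (simp add: norm_sq[OF c])
  qed
  also have "\<dots> = of_int (p - 1) * (J * cnj J)" using p_gt_1 by (simp add: of_nat_nat)
  finally have 1: "(\<Sum>c\<in>{0..<p}. Jc c * cnj (Jc c)) = of_int (p - 1) * (J * cnj J)" .
  have "(\<Sum>c\<in>{0..<p}. Jc c * cnj (Jc c)) =
        (\<Sum>c\<in>{0..<p}. \<Sum>t\<in>{0..<p}. \<Sum>s\<in>{0..<p}. ch t * cnj (ch s) * (ch (c - t) * cnj (ch (c - s))))"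
    unfolding Jc_def cnj_sum sum_product by (simp add: mult_ac)
  also have "\<dots> = (\<Sum>t\<in>{0..<p}. \<Sum>s\<in>{0..<p}. ch t * cnj (ch s) *
                    (\<Sum>c\<in>{0..<p}. ch (c - t) * cnj (ch (c - s))))"
    unfolding sum_distrib_left
    by (subst sum.swap, rule sum.cong[OF refl], rule sum.swap)
  \<comment> \<open>The sum over c is the correlation at the shift t - s. Its constant -1 then
    disappears, because the conjugates of chi(s) add up to 0.\<close>
  also have "\<dots> = (\<Sum>t\<in>{0..<p}. \<Sum>s\<in>{0..<p}. ch t * cnj (ch s) * ((if t = s then of_int p else 0) - 1))"
  proof (intro sum.cong refl arg_cong2[where f = "(*)"])
    fix t s assume ts: "t \<in> {0..<p}" "s \<in> {0..<p}"
    have per: "ch (x mod p) * cnj (ch (x mod p + (t - s))) = ch x * cnj (ch (x + (t - s)))" for x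
    proof -
      have "ch (x mod p + (t - s)) = ch (x + (t - s))" by (intro cong) (simp add: cong_def mod_add_left_eq)
      thus ?thesis by (simp add: periodic)
    qed
    have "(\<Sum>c\<in>{0..<p}. ch (c - t) * cnj (ch (c - s))) =
          (\<Sum>c\<in>{0..<p}. ch (c + - t) * cnj (ch ((c + - t) + (t - s))))" by simp
    also have "\<dots> = (\<Sum>c\<in>{0..<p}. ch c * cnj (ch (c + (t - s))))"
      by (rule sum_residues_shift[where f = "\<lambda>u. ch u * cnj (ch (u + (t - s)))"])
         (use p_gt_1 per in auto)
    also have "\<dots> = (if p dvd t - s then of_int p else 0) - 1" by (rule correlation)
    also have "p dvd t - s \<longleftrightarrow> t = s"
      using ts by (metis atLeastLessThan_iff mod_eq_dvd_iff mod_pos_pos_trivial)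
    finally show "(\<Sum>c\<in>{0..<p}. ch (c - t) * cnj (ch (c - s))) = (if t = s then of_int p else 0) - 1" .
  qed
  also have "\<dots> = (\<Sum>t\<in>{0..<p}. ch t * cnj (ch t) * of_int p)"
  proof (intro sum.cong refl)
    fix t assume t: "t \<in> {0..<p}"
    have "(\<Sum>s\<in>{0..<p}. ch t * cnj (ch s) * ((if t = s then of_int p else 0) - 1)) =
          (\<Sum>s\<in>{0..<p}. (if t = s then ch t * cnj (ch s) * of_int p else 0)) - ch t * (\<Sum>s\<in>{0..<p}. cnj (ch s))"
      unfolding sum_distrib_left sum_subtractf[symmetric] by (intro sum.cong) (auto simp: algebra_simps)
    also have "\<dots> = ch t * cnj (ch t) * of_int p" using t by (simp add: sum_cnj_eq_0)
    finally show "(\<Sum>s\<in>{0..<p}. ch t * cnj (ch s) * ((if t = s then of_int p else 0) - 1)) =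
                  ch t * cnj (ch t) * of_int p" .
  qed
  also have "\<dots> = of_int (p - 1) * of_int p" by (simp only: sum_distrib_right[symmetric] sum_norm_sq)
  finally have "of_int (p - 1) * (J * cnj J) = of_int (p - 1) * of_int p" using 1 by simp
  moreover have "(of_int (p - 1) :: complex) \<noteq> 0" using p_gt_1 by (simp only: of_int_eq_0_iff)
  ultimately show ?thesis by (metis mult_cancel_left)
qed

lemma J_eq: "J = (\<Sum>t\<in>{2..<p}. ch t * ch (1 - t))"
  by (simp add: J_def sum_split_0_1)

lemma not_dvd_residue_1: "t \<in> {2..<p} \<Longrightarrow> \<not> p dvd t \<and> \<not> p dvd (1 - t)"
  using not_dvd_residue[of t] not_dvd_residue[of "t - 1"] dvd_diff_commute[of p 1 t] by auto

(* chi(t) - 1 is divisible by 1 - omega, and (1 - omega)^2 is an associate of 3. *)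
lemma J_mod_3: "\<exists>a b. J = of_int (3 * a - p) + of_int (3 * b) * omega"
proof -
  have three: "(ch x - 1) * (ch y - 1) \<in> (*) 3 ` eisenstein" if "\<not> p dvd x" "\<not> p dvd y" for x y
  proof -
    have w4: "omega * omega\<^sup>2 = 1" "omega\<^sup>2 * omega\<^sup>2 = omega"
      using omega_cube by (simp_all add: eval_nat_numeral)
    define M where "M = (*) 3 ` eisenstein"
    have M: "3 * (of_int a + of_int b * omega) \<in> M" for a b
      unfolding M_def by (intro imageI eisensteinI)
    have "(omega - 1) * (omega - 1) = omega\<^sup>2 - 2 * omega + 1"
      by (simp add: algebra_simps power2_eq_square)
    also have "\<dots> = 3 * (of_int 0 + of_int (-1) * omega)" by (simp add: omega_sq)
    finally have 1: "(omega - 1) * (omega - 1) \<in> M" by (simp only: M)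
    have "(omega - 1) * (omega\<^sup>2 - 1) = omega * omega\<^sup>2 - omega - omega\<^sup>2 + 1"
      by (simp add: left_diff_distrib right_diff_distrib)
    also have "\<dots> = 3 * (of_int 1 + of_int 0 * omega)" unfolding w4 by (simp add: omega_sq)
    finally have 2: "(omega - 1) * (omega\<^sup>2 - 1) \<in> M" by (simp only: M)
    hence 3: "(omega\<^sup>2 - 1) * (omega - 1) \<in> M" by (simp only: mult.commute)
    have "(omega\<^sup>2 - 1) * (omega\<^sup>2 - 1) = omega\<^sup>2 * omega\<^sup>2 - 2 * omega\<^sup>2 + 1"
      by (simp add: left_diff_distrib right_diff_distrib)
    also have "\<dots> = 3 * (of_int 1 + of_int 1 * omega)" unfolding w4 by (simp add: omega_sq)
    finally have 4: "(omega\<^sup>2 - 1) * (omega\<^sup>2 - 1) \<in> M" by (simp only: M)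
    have 0: "0 \<in> M" using M[of 0 0] by simp
    have "(ch x - 1) * (ch y - 1) \<in> M"
      using cube[OF that(1)] cube[OF that(2)]
      by (elim insertE emptyE) (simp_all only: 0 1 2 3 4 diff_self mult_zero_left mult_zero_right)
    thus ?thesis by (simp add: M_def)
  qed
  have "(\<Sum>t\<in>{2..<p}. (ch t - 1) * (ch (1 - t) - 1)) \<in> (*) 3 ` eisenstein"
  proof -
    have "\<exists>g. \<forall>t\<in>{2..<p}. g t \<in> eisenstein \<and> (ch t - 1) * (ch (1 - t) - 1) = 3 * g t"
    proof (intro bchoice ballI)
      fix t assume "t \<in> {2..<p}"
      hence "(ch t - 1) * (ch (1 - t) - 1) \<in> (*) 3 ` eisenstein"
        using three not_dvd_residue_1 by blast
      thus "\<exists>y. y \<in> eisenstein \<and> (ch t - 1) * (ch (1 - t) - 1) = 3 * y" by blast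
    qed
    then obtain g where g: "\<And>t. t \<in> {2..<p} \<Longrightarrow> g t \<in> eisenstein \<and> (ch t - 1) * (ch (1 - t) - 1) = 3 * g t"
      by blast
    have "(\<Sum>t\<in>{2..<p}. (ch t - 1) * (ch (1 - t) - 1)) = 3 * sum g {2..<p}"
      using g by (simp add: sum_distrib_left)
    thus ?thesis using eisenstein_sum[of "{2..<p}" g] g by blast
  qed
  \<comment> \<open>Expanding gives J + 1 + 1 + (p - 2), the source of -p in the first
    coefficient.\<close>
  moreover have "(\<Sum>t\<in>{2..<p}. (ch t - 1) * (ch (1 - t) - 1)) = J + of_int p"
  proof -
    have s1: "(\<Sum>t\<in>{2..<p}. ch t) = -1" using sum_eq_0 by (simp add: sum_split_0_1 add_eq_0_iff)
    have "(\<Sum>t\<in>{0..<p}. ch (1 - t)) = (\<Sum>t\<in>{0..<p}. ch (-1 * (t + (-1))))" by (simp add: algebra_simps)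
    also have "\<dots> = (\<Sum>t\<in>{0..<p}. ch (-1 * t))"
      using p_gt_1
      by (intro sum_residues_shift[where f = "\<lambda>t. ch (-1 * t)"]) (simp, simp only: mult periodic)
    also have "\<dots> = 0" unfolding mult using sum_eq_0 by (simp add: sum_distrib_left[symmetric])
    finally have s2: "(\<Sum>t\<in>{2..<p}. ch (1 - t)) = -1" by (simp add: sum_split_0_1 add_eq_0_iff)
    have "(\<Sum>t\<in>{2..<p}. (ch t - 1) * (ch (1 - t) - 1)) =
          J - (\<Sum>t\<in>{2..<p}. ch t) - (\<Sum>t\<in>{2..<p}. ch (1 - t)) + (\<Sum>t\<in>{2..<p}. 1)"
      unfolding J_eq sum_subtractf[symmetric] sum.distrib[symmetric]
      by (intro sum.cong) (auto simp: algebra_simps)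
    thus ?thesis using p_gt_1 by (simp add: s1 s2 of_nat_nat)
  qed
  ultimately obtain a b where "J + of_int p = 3 * (of_int a + of_int b * omega)"
    by (auto simp: eisenstein_def)
  hence "J = of_int (3 * a - p) + of_int (3 * b) * omega"
    by (simp add: algebra_simps eq_diff_eq)
  thus ?thesis by blast
qed

(* The involution t -> 1 - t of the summands of J fixes only t = 1/2. *)
lemma J_mod_2:
  assumes "odd p"
  shows "\<exists>a b. J = ch 2 + 2 * (of_int a + of_int b * omega)"
proof -
  obtain h where h: "p = 2 * h + 1" using assms by (elim oddE)
  have h1: "h \<ge> 1" using p_gt_1 h by simp
  define g where "g t = ch t * ch (1 - t)" for t
  \<comment> \<open>2h + 2 - t = p + 1 - t is the representative of 1 - t in {2..<p}, and the fixed
    point h + 1 is the inverse of 2 modulo p.\<close>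
  have g_sym: "g (2 * h + 2 - t) = g t" for t
  proof -
    have "2 * h + 2 - t - (1 - t) = p" "1 - (2 * h + 2 - t) - t = - p" using h by simp_all
    hence "ch (2 * h + 2 - t) = ch (1 - t)" "ch (1 - (2 * h + 2 - t)) = ch t"
      by (auto intro!: cong simp only: cong_iff_dvd_diff dvd_minus_iff dvd_refl)
    thus ?thesis by (simp add: g_def)
  qed
  have "{2..<p} = {2..h} \<union> insert (h + 1) {h+2..2*h}" using h h1 by auto
  hence "J = (\<Sum>t\<in>{2..h} \<union> insert (h + 1) {h+2..2*h}. g t)" by (simp add: J_eq g_def)
  also have "\<dots> = (\<Sum>t\<in>{2..h}. g t) + (g (h + 1) + (\<Sum>t\<in>{h+2..2*h}. g t))"
    by (subst sum.union_disjoint) auto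
  also have "(\<Sum>t\<in>{h+2..2*h}. g t) = (\<Sum>t\<in>{2..h}. g t)"
    by (rule sum.reindex_bij_witness[of _ "\<lambda>t. 2 * h + 2 - t" "\<lambda>t. 2 * h + 2 - t"]) (auto simp: g_sym)
  \<comment> \<open>chi(1/2)^2 = chi(2)^(-2) = chi(2), because chi(2)^3 = 1.\<close>
  also have "g (h + 1) = ch 2"
  proof -
    have "1 - (h + 1) - (h + 1) = - p" using h by simp
    hence "ch (1 - (h + 1)) = ch (h + 1)"
      by (intro cong) (simp only: cong_iff_dvd_diff dvd_minus_iff dvd_refl)
    hence g: "g (h + 1) = ch (h + 1) ^ 2" by (simp add: g_def power2_eq_square)
    have "2 * (h + 1) - 1 = p" using h by simp
    hence "ch (2 * (h + 1)) = ch 1" by (intro cong) (simp only: cong_iff_dvd_diff dvd_refl)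
    hence inv: "ch 2 * ch (h + 1) = 1" by (simp only: mult one)
    hence "\<not> p dvd (h + 1)" using eq_0_iff[of "h + 1"] by auto
    hence "ch (h + 1) * ch (h + 1) ^ 2 = 1" using power_3 by (simp add: eval_nat_numeral)
    thus ?thesis using inv unfolding g
      by (metis mult.assoc mult.commute mult_1)
  qed
  finally have "J = ch 2 + 2 * (\<Sum>t\<in>{2..h}. g t)" by simp
  moreover have "(\<Sum>t\<in>{2..h}. g t) \<in> eisenstein"
    unfolding g_def by (intro eisenstein_sum eisenstein_mult in_eisenstein)
  moreover from this obtain a b where "(\<Sum>t\<in>{2..h}. g t) = of_int a + of_int b * omega"
    unfolding eisenstein_def by blast
  ultimately show ?thesis by metis
qed

text \<open>With c = 3a - p and 3d as the coefficients of J, the equation |J|^2 = p is the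
  representation. Modulo 2 the coefficient 3d of omega agrees with that of chi(2), which is 0 for
  the value 1 and odd for omega and omega^2 = -1 - omega.\<close>

lemma norm_form_representation:
  assumes "odd p"
  shows "\<exists>c d. c\<^sup>2 - 3 * c * d + 9 * d\<^sup>2 = p \<and> (even d \<longleftrightarrow> ch 2 = 1)"
proof -
  obtain a d where J3: "J = of_int (3 * a - p) + of_int (3 * d) * omega" using J_mod_3 by blast
  obtain a' b' where J2: "J = ch 2 + 2 * (of_int a' + of_int b' * omega)" using J_mod_2[OF assms] by blast
  have "(of_int ((3*a-p)\<^sup>2 - (3*a-p) * (3*d) + (3*d)\<^sup>2) :: complex) = of_int p"
    using J_norm unfolding J3 eisenstein_norm .
  hence "(3*a-p)\<^sup>2 - (3*a-p) * (3*d) + (3*d)\<^sup>2 = p" by (simp only: of_int_eq_iff)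
  hence "(3*a-p)\<^sup>2 - 3 * (3*a-p) * d + 9 * d\<^sup>2 = p" by (simp add: power2_eq_square mult_ac)
  moreover have "even d \<longleftrightarrow> ch 2 = 1"
  proof -
    have "\<not> p dvd 2" using assms p_gt_1 zdvd_imp_le[of p 2] by (cases "p = 2") auto
    then consider "ch 2 = 1" | "ch 2 = omega" | "ch 2 = omega\<^sup>2" using cube[of 2] by blast
    thus ?thesis
    proof cases
      case 1
      have "of_int (3 * a - p) + of_int (3 * d) * omega = of_int (1 + 2 * a') + of_int (2 * b') * omega"
        using J3 J2 1 by (simp add: algebra_simps)
      hence "3 * d = 2 * b'" by (rule eisenstein_coeffs_unique)
      hence "even d" by presburger
      thus ?thesis using 1 by simp
    next
      case 2
      have "of_int (3 * a - p) + of_int (3 * d) * omega = of_int (2 * a') + of_int (1 + 2 * b') * omega"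
        using J3 J2 2 by (simp add: algebra_simps)
      hence "3 * d = 1 + 2 * b'" by (rule eisenstein_coeffs_unique)
      hence "odd d" by presburger
      thus ?thesis using 2 omega_neq_1 by simp
    next
      case 3
      have "of_int (3 * a - p) + of_int (3 * d) * omega = of_int (2 * a' - 1) + of_int (2 * b' - 1) * omega"
        using J3 J2 3 by (simp add: algebra_simps omega_sq)
      hence "3 * d = 2 * b' - 1" by (rule eisenstein_coeffs_unique)
      hence "odd d" by presburger
      moreover have "omega\<^sup>2 \<noteq> 1" by (simp add: omega_sq) (simp add: omega_def complex_eq_iff)
      ultimately show ?thesis using 3 by simp
    qed
  qed
  ultimately show ?thesis by blast
qed

end

section \<open>Existence of a cubic residue character\<close>

text \<open>The character sends x to omega^i when x^((p-1)/3) is congruent to r^i, with r a fixed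
  primitive cube root of unity modulo p. This builds the cubic analogue of Euler's criterion into
  the construction, and the condition on 2 is an instance of it.\<close>

lemma cubic_character_exists:
  fixes p :: nat
  assumes p: "prime p" and p3: "[p = 1] (mod 3)"
  shows "\<exists>ch. cubic_character (int p) ch \<and> (ch 2 = 1 \<longleftrightarrow> [2 ^ ((p - 1) div 3) = 1] (mod p))"
proof -
  define h where "h = (p - 1) div 3"
  define P where "P = int p"
  have P: "prime P" using p by (simp add: P_def)
  have h3: "3 * h = p - 1" using p3 unfolding h_def cong_def by presburger
  have p1: "p > 1" using p by (rule prime_gt_1_nat)
  hence h0: "h > 0" using h3 by (intro Nat.gr0I) auto
  have fermat: "[(x ^ h) ^ 3 = 1] (mod P)" if "\<not> P dvd x" for x
  proof -
    define n where "n = nat (x mod P)"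
    have n: "int n = x mod P" using p1 by (simp add: n_def P_def)
    hence "\<not> p dvd n" using that by (metis P_def dvd_mod_iff dvd_refl int_dvd_int_iff)
    hence "[n ^ (p - 1) = 1] (mod p)" using p by (intro fermat_theorem)
    hence "[int n ^ (p - 1) = 1] (mod P)" unfolding P_def by (metis cong_int_iff of_nat_1 of_nat_power)
    moreover have "[int n ^ (p - 1) = x ^ (p - 1)] (mod P)" unfolding n by (intro cong_pow) simp
    ultimately have "[x ^ (p - 1) = 1] (mod P)" using cong_sym cong_trans by blast
    thus ?thesis by (simp only: h3[symmetric] power_mult[symmetric] mult.commute)
  qed
  \<comment> \<open>x^h = 1 has at most h roots among p - 1 = 3h residues, and for a non-root g the
    power g^h is a cube root of unity other than 1.\<close>
  obtain g where g: "\<not> P dvd g" "\<not> [g ^ h = 1] (mod P)"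
  proof -
    have "\<not> {1..<p} \<subseteq> {x\<in>{..<p}. [x ^ h = 1] (mod p)}"
    proof
      assume "{1..<p} \<subseteq> {x\<in>{..<p}. [x ^ h = 1] (mod p)}"
      hence "card {1..<p} \<le> card {x\<in>{..<p}. [x ^ h = 1] (mod p)}" by (intro card_mono) auto
      also have "\<dots> \<le> h" using p h0 by (rule roots_mod_prime_bound)
      finally show False using h3 h0 by simp
    qed
    then obtain x where "x \<in> {1..<p}" "x \<notin> {x\<in>{..<p}. [x ^ h = 1] (mod p)}" by blast
    hence x: "x \<in> {1..<p}" "\<not> [x ^ h = 1] (mod p)" by simp_all
    show ?thesis
    proof (rule that[of "int x"])
      show "\<not> P dvd int x" using x(1) by (auto simp: P_def dest: dvd_imp_le)
      show "\<not> [int x ^ h = 1] (mod P)" using x(2) unfolding P_def by (metis cong_int_iff of_nat_1 of_nat_power)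
    qed
  qed
  define r where "r = g ^ h"
  have r1: "\<not> P dvd (r - 1)" using g(2) by (simp add: r_def cong_iff_dvd_diff)
  have r3: "P dvd (r ^ 3 - 1)" using fermat[OF g(1)] by (simp add: r_def cong_iff_dvd_diff)
  have "r ^ 3 - 1 = (r - 1) * (r\<^sup>2 + r + 1)" by (simp add: algebra_simps eval_nat_numeral)
  hence r2: "P dvd (r\<^sup>2 + r + 1)" using r1 r3 P by (simp add: prime_dvd_mult_iff)
  have cases: "\<exists>i<3. [x ^ h = r ^ i] (mod P)" if "\<not> P dvd x" for x
  proof -
    define T where "T = x ^ h"
    have "P dvd (T ^ 3 - 1)" using fermat[OF that] by (simp add: T_def cong_iff_dvd_diff)
    \<comment> \<open>The factorization T^3 - 1 = (T - 1)(T - r)(T - r^2) modulo P; the correction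
      term combines r^2 + r + 1 and r^3 - 1, both divisible by P.\<close>
    moreover have "(T - 1) * ((T - r) * (T - r\<^sup>2)) = (T ^ 3 - 1) - (T - 1) * (T * (r\<^sup>2 + r + 1) - (r ^ 3 - 1))"
      by (simp add: algebra_simps eval_nat_numeral)
    ultimately have "P dvd (T - 1) * ((T - r) * (T - r\<^sup>2))" using r2 r3 by simp
    hence "P dvd (T - r ^ 0) \<or> P dvd (T - r ^ 1) \<or> P dvd (T - r ^ 2)"
      using P by (simp add: prime_dvd_mult_iff)
    thus ?thesis unfolding T_def cong_iff_dvd_diff
      by (elim disjE) (auto intro: exI[of _ 0] exI[of _ 1] exI[of _ 2])
  qed
  define idx where "idx x = (LEAST i. [x ^ h = r ^ i] (mod P))" for x
  define ch where "ch x = (if P dvd x then 0 else omega ^ idx x)" for x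
  have r_red: "[r ^ i = r ^ (i mod 3)] (mod P)" for i
  proof -
    have "[(r ^ 3) ^ (i div 3) = 1 ^ (i div 3)] (mod P)" using r3 by (intro cong_pow) (simp add: cong_iff_dvd_diff)
    hence "[(r ^ 3) ^ (i div 3) * r ^ (i mod 3) = 1 ^ (i div 3) * r ^ (i mod 3)] (mod P)" by (rule cong_scalar_right)
    thus ?thesis by (simp add: power_mult[symmetric] power_add[symmetric])
  qed
  have w_red: "omega ^ i = omega ^ (i mod 3)" for i
  proof -
    have "omega ^ (3 * (i div 3) + i mod 3) = omega ^ (i mod 3)" 
      by (simp only: power_add power_mult omega_cube power_one mult_1)
    thus ?thesis by simp
  qed
  have r_inj: "i = j" if "i < 3" "j < 3" "[r ^ i = r ^ j] (mod P)" for i j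
  proof -
    have 1: "\<not> P dvd (r\<^sup>2 - 1)"
    proof
      assume "P dvd (r\<^sup>2 - 1)"
      hence "P dvd (r ^ 3 - 1) - r * (r\<^sup>2 - 1)" using r3 by simp
      also have "\<dots> = r - 1" by (simp add: algebra_simps eval_nat_numeral)
      finally show False using r1 by simp
    qed
    have 2: "\<not> P dvd (r\<^sup>2 - r)"
    proof
      assume "P dvd (r\<^sup>2 - r)"
      hence "P dvd (r ^ 3 - 1) - (r + 1) * (r\<^sup>2 - r)" using r3 by simp
      also have "\<dots> = r - 1" by (simp add: algebra_simps eval_nat_numeral)
      finally show False using r1 by simp
    qed
    have "i \<in> {0, 1, 2}" "j \<in> {0, 1, 2}" using that by auto
    thus ?thesis using that(3) r1 1 2 dvd_diff_commute[of P]
      unfolding cong_iff_dvd_diff by (auto simp: power2_eq_square)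
  qed
  \<comment> \<open>Any exponent i with x^h congruent to r^i computes \<open>ch x\<close>, not only
    the least one; multiplicativity can thus use i + j unreduced.\<close>
  have chI: "ch x = omega ^ i" if "\<not> P dvd x" "[x ^ h = r ^ i] (mod P)" for x i
  proof -
    have "[x ^ h = r ^ idx x] (mod P)" unfolding idx_def using that(2) by (rule LeastI)
    hence "[r ^ (i mod 3) = r ^ (idx x mod 3)] (mod P)"
      using that(2) r_red by (meson cong_sym cong_trans)
    hence "i mod 3 = idx x mod 3" by (intro r_inj) auto
    thus ?thesis using that(1) w_red[of i] w_red[of "idx x"] by (simp add: ch_def)
  qed
  have "cubic_character P ch"
  proof
    show "ch (x mod P) = ch x" for x
    proof (cases "P dvd x")
      case False
      then obtain i where i: "[x ^ h = r ^ i] (mod P)" using cases by blast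
      moreover have "[(x mod P) ^ h = x ^ h] (mod P)" by (intro cong_pow) simp
      ultimately have "[(x mod P) ^ h = r ^ i] (mod P)" using cong_trans by blast
      thus ?thesis using chI[OF False i] chI[of "x mod P" i] False by (simp add: dvd_mod_iff)
    qed (simp add: ch_def dvd_mod_iff)
    show "ch (x * y) = ch x * ch y" for x y
    proof (cases "P dvd x \<or> P dvd y")
      case False
      then obtain i j where ij: "[x ^ h = r ^ i] (mod P)" "[y ^ h = r ^ j] (mod P)" using cases by blast
      have "[(x * y) ^ h = r ^ (i + j)] (mod P)"
        using cong_mult[OF ij] by (simp add: power_mult_distrib power_add)
      moreover have "\<not> P dvd x * y" using False P by (simp add: prime_dvd_mult_iff)
      ultimately show ?thesis using chI[of x i] chI[of y j] chI[of "x * y" "i + j"] ij False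
        by (simp add: power_add)
    qed (auto simp: ch_def)
    have w0: "omega \<noteq> 0" by (simp add: omega_def complex_eq_iff)
    show "(ch x = 0) = (P dvd x)" for x by (simp add: ch_def w0)
    show "ch x \<in> {1, omega, omega\<^sup>2}" if "\<not> P dvd x" for x
    proof -
      obtain i where i: "i < 3" "[x ^ h = r ^ i] (mod P)" using cases \<open>\<not> P dvd x\<close> by blast
      thus ?thesis using chI[OF that i(2)] by (auto simp: less_Suc_eq numeral_3_eq_3 power2_eq_square)
    qed
    have "ch g = omega ^ 1" using g(1) by (rule chI) (simp add: r_def)
    thus "\<exists>x. \<not> P dvd x \<and> ch x \<noteq> 1" using g(1) omega_neq_1 by auto
  qed (rule P)
  moreover have "ch 2 = 1 \<longleftrightarrow> [2 ^ h = 1] (mod p)"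
  proof -
    have "p \<noteq> 2" using p3 by (auto simp: cong_def)
    hence P2: "\<not> P dvd 2" using p1 P_def zdvd_imp_le[of P 2] by auto
    then obtain i where i: "i < 3" "[2 ^ h = r ^ i] (mod P)" using cases by blast
    have "[(2::nat) ^ h = 1] (mod p) \<longleftrightarrow> [2 ^ h = r ^ 0] (mod P)"
      unfolding P_def using cong_int_iff[of "2 ^ h" 1 p] by simp
    also have "\<dots> \<longleftrightarrow> i = 0" using i r_inj[of i 0] by (auto dest: cong_trans[OF cong_sym[OF i(2)]])
    also have "\<dots> \<longleftrightarrow> ch 2 = 1"
    proof -
      have "omega\<^sup>2 \<noteq> 1" by (simp add: omega_sq) (simp add: omega_def complex_eq_iff)
      hence "omega ^ i = 1 \<longleftrightarrow> i = 0"
        using i(1) omega_neq_1 by (auto simp: less_Suc_eq numeral_3_eq_3 power2_eq_square)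
      thus ?thesis using chI[OF P2 i(2)] by simp
    qed
    finally show ?thesis by simp
  qed
  ultimately show ?thesis unfolding P_def h_def by blast
qed

lemma prime_norm_form_representation:
  fixes p :: nat
  assumes "prime p" and "[p = 1] (mod 3)"
  shows "\<exists>c d::int. c\<^sup>2 - 3 * c * d + 9 * d\<^sup>2 = int p \<and> (even d \<longleftrightarrow> [2 ^ ((p - 1) div 3) = 1] (mod p))"
proof -
  obtain ch where ch: "cubic_character (int p) ch" "ch 2 = 1 \<longleftrightarrow> [2 ^ ((p - 1) div 3) = 1] (mod p)"
    using cubic_character_exists[OF assms] by blast
  have "p \<noteq> 2" using assms(2) by (auto simp: cong_def)
  hence "odd (int p)" using assms(1) prime_odd_nat prime_gt_1_nat[of p] by force
  with cubic_character.norm_form_representation[OF ch(1)] ch(2) show ?thesis by auto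
qed

section \<open>Hecke recursions for the norm form\<close>

text \<open>The principal form of discriminant -27. Restricting it to a sublattice of index 2
  multiplies the discriminant by 4, which leads to the two forms of discriminant -108.\<close>

definition norm_form :: "int \<times> int \<Rightarrow> int" where
  "norm_form = (\<lambda>(x, y). x\<^sup>2 - 3 * x * y + 9 * y\<^sup>2)"

definition reps :: "nat \<Rightarrow> (int \<times> int) set" where
  "reps n = {z. norm_form z = int n}"

definition wsum :: "(int \<times> int \<Rightarrow> int) \<Rightarrow> nat \<Rightarrow> int" where
  "wsum W n = (\<Sum>z\<in>reps n. W z)"

text \<open>Completing the square in either variable bounds both coordinates. On an infinite set
  \<open>sum\<close> and \<open>card\<close> would default to 0.\<close>

lemma finite_reps: "finite (reps n)"
proof (rule finite_subset)
  show "reps n \<subseteq> {-2 * int n..2 * int n} \<times> {-2 * int n..2 * int n}"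
  proof
    fix z assume "z \<in> reps n"
    then obtain x y where z: "z = (x, y)" and n: "x\<^sup>2 - 3 * x * y + 9 * y\<^sup>2 = int n"
      by (cases z) (auto simp: reps_def norm_form_def)
    have "4 * int n = (2 * x - 3 * y)\<^sup>2 + 27 * y\<^sup>2" "4 * int n = (6 * y - x)\<^sup>2 + 3 * x\<^sup>2"
      unfolding n[symmetric] by (simp_all add: power2_eq_square algebra_simps)
    hence "27 * y\<^sup>2 \<le> 4 * int n" "3 * x\<^sup>2 \<le> 4 * int n"
      using zero_le_power2[of "2 * x - 3 * y"] zero_le_power2[of "6 * y - x"] by linarith+
    moreover have le: "\<bar>t\<bar> \<le> t\<^sup>2" for t :: int
    proof (cases "t = 0")
      case False
      hence "\<bar>t\<bar> * 1 \<le> \<bar>t\<bar> * \<bar>t\<bar>" by (intro mult_left_mono) auto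
      thus ?thesis by (simp add: power2_eq_square)
    qed simp
    ultimately have "\<bar>x\<bar> \<le> 2 * int n" "\<bar>y\<bar> \<le> 2 * int n" using le[of x] le[of y] by linarith+
    thus "z \<in> {-2 * int n..2 * int n} \<times> {-2 * int n..2 * int n}" by (auto simp: z)
  qed
qed simp

text \<open>\<open>f\<close> and \<open>g\<close> multiply x + 3 y omega by c + 3 d omega and by its
  conjugate, both of norm p. Every element of norm p n lies in the image of one of them, and in both
  images exactly when it is p times an element of the order; inclusion-exclusion gives the
  recursion. \<open>t\<close> plays the role of a Hecke eigenvalue of the weight.\<close>

lemma wsum_prime_split:
  fixes p :: nat and c d :: int
  assumes p: "prime p" "p > 3" and cd: "norm_form (c, d) = int p"
  defines "f \<equiv> \<lambda>(x, y). (c * x - 9 * d * y, c * y + d * x - 3 * d * y)"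
    and "g \<equiv> \<lambda>(x, y). ((c - 3 * d) * x + 9 * d * y, c * y - d * x)"
  assumes Wfg: "\<And>z. W (f z) + W (g z) = t * W z"
    and Wp: "\<And>x y. W (int p * x, int p * y) = W (x, y)"
  shows "wsum W (p * n) = t * wsum W n - (if p dvd n then wsum W (n div p) else 0)"
proof -
  define P where "P = int p"
  have P: "prime P" "P > 3" "P \<noteq> 0" using p by (auto simp: P_def)
  have cd: "c\<^sup>2 - 3 * c * d + 9 * d\<^sup>2 = P" using cd by (simp add: norm_form_def P_def)
  have norm_f: "norm_form (f z) = P * norm_form z" for z
    unfolding cd[symmetric] by (cases z) (simp add: f_def norm_form_def power2_eq_square algebra_simps)
  have norm_g: "norm_form (g z) = P * norm_form z" for z
    unfolding cd[symmetric] by (cases z) (simp add: g_def norm_form_def power2_eq_square algebra_simps)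
  have gf: "g (f (x, y)) = (P * x, P * y)" for x y
    unfolding cd[symmetric] by (simp add: f_def g_def power2_eq_square algebra_simps)
  have fg: "f (g (x, y)) = (P * x, P * y)" for x y
    unfolding cd[symmetric] by (simp add: f_def g_def power2_eq_square algebra_simps)
  have inj_scale: "u = v" if "(P * fst u, P * snd u) = (P * fst v, P * snd v)" for u v :: "int \<times> int"
    using that P by (auto simp: prod_eq_iff)
  have inj_f: "inj f" by (rule injI, rule inj_scale) (metis gf prod.collapse)
  have inj_g: "inj g" by (rule injI, rule inj_scale) (metis fg prod.collapse)
  have P_dvd_sq: "P dvd x" if "P dvd x\<^sup>2" for x
    using P that prime_dvd_power by blast
  have not_d: "\<not> P dvd d"
  proof
    assume d: "P dvd d"
    have "c\<^sup>2 = P + d * (3 * c - 9 * d)" using cd by (simp add: power2_eq_square algebra_simps)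
    hence "P dvd c\<^sup>2" using d by simp
    hence "P dvd c" by (rule P_dvd_sq)
    then obtain c' d' where "c = P * c'" "d = P * d'" using d by (elim dvdE)
    hence "P * (P * (c'\<^sup>2 - 3 * c' * d' + 9 * d'\<^sup>2)) = P * 1"
      using cd by (simp add: power2_eq_square algebra_simps)
    hence "P dvd 1" using P(3) unfolding mult_cancel_left by (metis dvd_triv_left)
    thus False using P by simp
  qed
  have norm_scale: "norm_form (k * x, k * y) = k\<^sup>2 * norm_form (x, y)" for k x y
    by (simp add: norm_form_def power2_eq_square algebra_simps)
  have dvd_comp: "P dvd A" if "P dvd B" "P * P dvd norm_form (A, B)" for A B
  proof -
    have "A\<^sup>2 = norm_form (A, B) + B * (3 * A - 9 * B)" by (simp add: norm_form_def power2_eq_square algebra_simps)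
    moreover have "P dvd norm_form (A, B)" using that(2) by (rule dvd_mult_left)
    ultimately have "P dvd A\<^sup>2" using that(1) by simp
    thus ?thesis by (rule P_dvd_sq)
  qed
  have cover: "reps (p * n) = f ` reps n \<union> g ` reps n"
  proof (intro equalityI subsetI)
    fix z assume "z \<in> f ` reps n \<union> g ` reps n"
    thus "z \<in> reps (p * n)" by (auto simp: reps_def norm_f norm_g P_def)
  next
    fix z assume z: "z \<in> reps (p * n)"
    hence nz: "norm_form z = P * int n" by (simp add: reps_def P_def)
    obtain x y where xy: "z = (x, y)" by force
    \<comment> \<open>The two factors are \<open>snd (g z)\<close> and \<open>snd (f z)\<close>, so
      p divides one of them. If it is the first, \<open>dvd_comp\<close> makes \<open>g z\<close>
      divisible by p, and applying \<open>f\<close> to the quotient recovers z; the other case is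
      symmetric.\<close>
    have "(c * y - d * x) * (c * y + d * x - 3 * d * y) = y\<^sup>2 * P - d\<^sup>2 * norm_form z"
      unfolding cd[symmetric] xy norm_form_def by (simp add: power2_eq_square algebra_simps)
    hence "P dvd (c * y - d * x) * (c * y + d * x - 3 * d * y)" by (simp add: nz)
    then consider "P dvd snd (g z)" | "P dvd snd (f z)"
      using P by (auto simp: prime_dvd_mult_iff f_def g_def xy)
    thus "z \<in> f ` reps n \<union> g ` reps n"
    proof cases
      case 1
      have "P * P dvd norm_form (g z)" by (simp add: norm_g nz)
      hence "P dvd fst (g z)" using 1 dvd_comp[of "snd (g z)" "fst (g z)"] by simp
      then obtain A B where AB: "g z = (P * A, P * B)" using 1 by (metis dvdE prod.collapse)
      hence "f (g z) = (P * fst (f (A, B)), P * snd (f (A, B)))"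
        by (simp add: f_def algebra_simps)
      hence "z = f (A, B)" using fg[of x y] P(3) by (simp add: xy prod_eq_iff)
      moreover have "(A, B) \<in> reps n"
        using norm_f[of "(A, B)"] nz P(3) calculation by (simp add: reps_def)
      ultimately show ?thesis by blast
    next
      case 2
      have "P * P dvd norm_form (f z)" by (simp add: norm_f nz)
      hence "P dvd fst (f z)" using 2 dvd_comp[of "snd (f z)" "fst (f z)"] by simp
      then obtain A B where AB: "f z = (P * A, P * B)" using 2 by (metis dvdE prod.collapse)
      hence "g (f z) = (P * fst (g (A, B)), P * snd (g (A, B)))"
        by (simp add: g_def algebra_simps)
      hence "z = g (A, B)" using gf[of x y] P(3) by (simp add: xy prod_eq_iff)
      moreover have "(A, B) \<in> reps n"
        using norm_g[of "(A, B)"] nz P(3) calculation by (simp add: reps_def)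
      ultimately show ?thesis by blast
    qed
  qed
  define h where "h = (\<lambda>(x, y). (P * x, P * y))"
  \<comment> \<open>An equation in place of \<open>n div p\<close>: the set is empty when p does not
    divide n.\<close>
  define S where "S = {z. P * norm_form z = int n}"
  have inj_h: "inj h" using P(3) by (auto simp: inj_def h_def)
  have inter: "f ` reps n \<inter> g ` reps n = h ` S"
  proof (intro equalityI subsetI)
    fix z assume "z \<in> h ` S"
    then obtain x y where xy: "z = (P * x, P * y)" "P * norm_form (x, y) = int n" by (auto simp: h_def S_def)
    have "g (x, y) \<in> reps n" "f (x, y) \<in> reps n" using xy(2) by (simp_all add: reps_def norm_f norm_g)
    moreover have "z = f (g (x, y))" "z = g (f (x, y))" by (simp_all add: xy fg gf)
    ultimately show "z \<in> f ` reps n \<inter> g ` reps n" by blast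
  next
    fix z assume z: "z \<in> f ` reps n \<inter> g ` reps n"
    then obtain u v where uv: "z = f u" "z = g v" "u \<in> reps n" by blast
    obtain x y where xy: "z = (x, y)" by force
    \<comment> \<open>For z in both images, p divides both second components, hence their difference
      d(2x - 3y). With 4N = (2x - 3y)^2 + 27y^2 and p > 3 this forces p | y and then p | x.\<close>
    have "P dvd snd (f z)" using fg[of "fst v" "snd v"] by (simp add: uv(2))
    moreover have "P dvd snd (g z)" using gf[of "fst u" "snd u"] by (simp add: uv(1))
    ultimately have "P dvd snd (f z) - snd (g z)" by (rule dvd_diff)
    also have "snd (f z) - snd (g z) = d * (2 * x - 3 * y)" by (simp add: f_def g_def xy algebra_simps)
    finally have dx: "P dvd 2 * x - 3 * y" using not_d P(1) by (simp add: prime_dvd_mult_iff)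
    have nz: "norm_form z = P * int n" using uv by (simp add: norm_f reps_def)
    have "27 * y\<^sup>2 = 4 * norm_form z - (2 * x - 3 * y)\<^sup>2"
      by (simp add: xy norm_form_def power2_eq_square algebra_simps)
    also have "P dvd \<dots>" using dx nz by (simp add: power2_eq_square)
    finally have "P dvd 3 ^ 3 * y\<^sup>2" by simp
    moreover have "\<not> P dvd 3 ^ 3"
      using P zdvd_imp_le[of P 3] prime_dvd_power[OF P(1), of 3 3] by auto
    ultimately have "P dvd y" using P(1) P_dvd_sq by (simp only: prime_dvd_mult_iff) blast
    hence "P dvd 2 * x" using dx by (metis dvd_diffD dvd_mult zdvd_zdiffD)
    moreover have "\<not> P dvd 2" using P zdvd_imp_le[of P 2] by auto
    ultimately have "P dvd x" using P(1) by (simp add: prime_dvd_mult_iff)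
    then obtain x' y' where x'y': "x = P * x'" "y = P * y'" using \<open>P dvd y\<close> by (elim dvdE)
    hence "P * (P * norm_form (x', y')) = P * int n"
      using nz by (simp add: xy norm_scale power2_eq_square)
    hence "(x', y') \<in> S" using P(3) by (simp add: S_def)
    thus "z \<in> h ` S" using x'y' by (auto simp: h_def xy)
  qed
  have "wsum W (p * n) = (\<Sum>z\<in>f ` reps n. W z) + (\<Sum>z\<in>g ` reps n. W z) - (\<Sum>z\<in>h ` S. W z)"
    unfolding wsum_def cover inter[symmetric] using finite_reps by (intro sum_Un) auto
  also have "(\<Sum>z\<in>f ` reps n. W z) + (\<Sum>z\<in>g ` reps n. W z) = (\<Sum>z\<in>reps n. W (f z) + W (g z))"
    using inj_f inj_g by (subst (1 2) sum.reindex) (auto simp: sum.distrib intro: inj_on_subset)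
  also have "\<dots> = t * wsum W n" by (simp add: Wfg wsum_def sum_distrib_left)
  also have "(\<Sum>z\<in>h ` S. W z) = (\<Sum>z\<in>S. W z)"
    using inj_h by (subst sum.reindex) (auto intro: inj_on_subset sum.cong simp: h_def Wp P_def)
  also have "\<dots> = (if p dvd n then wsum W (n div p) else 0)"
  proof (cases "p dvd n")
    case True
    then obtain k where k: "n = p * k" by (elim dvdE)
    have "S = reps k" using P(3) by (auto simp: S_def reps_def k P_def)
    thus ?thesis using k p by (simp add: wsum_def)
  next
    case False
    have "S = {}"
    proof (rule ccontr)
      assume "S \<noteq> {}"
      then obtain z where "P * norm_form z = int n" by (auto simp: S_def)
      hence "P dvd int n" by (metis dvd_triv_left)
      thus False using False by (simp add: P_def)
    qed
    thus ?thesis using False by simp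
  qed
  finally show ?thesis .
qed

text \<open>Cubing is injective modulo such a prime, and x^3 - (-3y)^3 = (x + 3y) N(x, y). So p
  divides x + 3y, and at x = -3y the form takes the value 27y^2. The case p = 2 is included.\<close>

lemma prime_2_mod_3_dvd_norm_form:
  fixes p :: nat
  assumes p: "prime p" "[p = 2] (mod 3)" and dvd: "int p dvd norm_form (x, y)"
  shows "int p dvd x" "int p dvd y"
proof -
  define P where "P = int p"
  have P: "prime P" using p by (simp add: P_def)
  have cube_inj: "P dvd u - v" if "P dvd u ^ 3 - v ^ 3" for u v
  proof -
    \<comment> \<open>By Fermat the k-th power turns u^3 into u^(p+1), that is u^2. Equal cubes thus
      have equal squares, and the two together determine u modulo p.\<close>
    define k where "k = (p + 1) div 3"
    have k: "3 * k = p + 1" using p(2) unfolding k_def cong_def by presburger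
    have "[u ^ 3 = v ^ 3] (mod P)" using that by (simp add: cong_iff_dvd_diff)
    hence "[(u ^ 3) ^ k = (v ^ 3) ^ k] (mod P)" by (rule cong_pow)
    hence uv: "[u ^ (p + 1) = v ^ (p + 1)] (mod P)" by (simp only: power_mult[symmetric] k)
    have red: "[w ^ (p + 1) = w\<^sup>2] (mod P)" for w
    proof (cases "P dvd w")
      case True
      thus ?thesis by (simp add: cong_iff_dvd_diff power2_eq_square)
    next
      case False
      define n where "n = nat (w mod P)"
      have n: "int n = w mod P" using prime_gt_0_int[OF P] by (simp add: n_def)
      hence "\<not> p dvd n" using False by (metis P_def dvd_mod_iff dvd_refl int_dvd_int_iff)
      hence "[n ^ (p - 1) = 1] (mod p)" using p(1) by (intro fermat_theorem)
      hence "[int n ^ (p - 1) = 1] (mod P)" unfolding P_def by (metis cong_int_iff of_nat_1 of_nat_power)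
      moreover have "[int n ^ (p - 1) = w ^ (p - 1)] (mod P)" unfolding n by (intro cong_pow) simp
      ultimately have "[w ^ (p - 1) * w\<^sup>2 = 1 * w\<^sup>2] (mod P)"
        using cong_sym cong_trans cong_scalar_right by blast
      moreover have "p - 1 + 2 = p + 1" using prime_gt_0_nat[OF p(1)] by simp
      ultimately show ?thesis by (metis mult_1 power_add)
    qed
    have "[u\<^sup>2 = v\<^sup>2] (mod P)" using red[of u] red[of v] uv by (meson cong_sym cong_trans)
    hence sq: "P dvd u\<^sup>2 - v\<^sup>2" by (simp add: cong_iff_dvd_diff)
    show ?thesis
    proof (cases "P dvd v")
      case True
      hence "P dvd (u\<^sup>2 - v\<^sup>2) + v\<^sup>2" using sq by (intro dvd_add) (auto simp: power2_eq_square)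
      hence "P dvd u" using P prime_dvd_power by auto
      thus ?thesis using True by simp
    next
      case False
      have "v\<^sup>2 * (u - v) = (u ^ 3 - v ^ 3) - u * (u\<^sup>2 - v\<^sup>2)"
        by (simp add: power2_eq_square power3_eq_cube algebra_simps)
      hence "P dvd v\<^sup>2 * (u - v)" using that sq by simp
      thus ?thesis using False P by (auto simp: prime_dvd_mult_iff power2_eq_square)
    qed
  qed
  have dvd': "P dvd x\<^sup>2 - 3 * x * y + 9 * y\<^sup>2" using dvd by (simp add: norm_form_def P_def)
  have "x ^ 3 - (- (3 * y)) ^ 3 = (x + 3 * y) * (x\<^sup>2 - 3 * x * y + 9 * y\<^sup>2)"
    by (simp add: power2_eq_square power3_eq_cube algebra_simps)
  hence "P dvd x ^ 3 - (- (3 * y)) ^ 3" using dvd' by (simp only: dvd_mult)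
  hence "P dvd x - - (3 * y)" by (rule cube_inj)
  hence s: "P dvd x + 3 * y" by simp
  have "27 * y\<^sup>2 = (x\<^sup>2 - 3 * x * y + 9 * y\<^sup>2) - (x + 3 * y) * (x - 6 * y)"
    by (simp add: power2_eq_square algebra_simps)
  hence "P dvd 27 * y\<^sup>2" using s dvd' by (simp only: dvd_diff dvd_mult2)
  hence "P dvd 3 ^ 3 * y\<^sup>2" by simp
  moreover have "\<not> P dvd 3 ^ 3"
  proof
    assume "P dvd 3 ^ 3"
    hence "P dvd 3" using P prime_dvd_power by blast
    hence "p dvd 3" unfolding P_def by (metis int_dvd_int_iff of_nat_numeral)
    moreover have "prime (3::nat)" by simp
    ultimately have "p = 3" using p(1) primes_dvd_imp_eq by blast
    thus False using p(2) by (simp add: cong_def)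
  qed
  ultimately have y: "P dvd y" using P by (simp only: prime_dvd_mult_iff) (auto simp: power2_eq_square prime_dvd_mult_iff)
  moreover have "P dvd (x + 3 * y) - 3 * y" using s y by (intro dvd_diff) auto
  ultimately show "int p dvd x" "int p dvd y" by (simp_all add: P_def)
qed

text \<open>An inert prime dividing the norm divides the element, so division by p maps the
  solutions for p n onto those for n / p. This is a recursion with t = 0.\<close>

lemma wsum_prime_inert:
  fixes p :: nat
  assumes p: "prime p" "[p = 2] (mod 3)" and W: "\<And>x y. W (int p * x, int p * y) = W (x, y)"
  shows "wsum W (p * n) = (if p dvd n then wsum W (n div p) else 0)"
proof -
  have p0: "p > 0" using p(1) by (rule prime_gt_0_nat)
  define h where "h = (\<lambda>(x, y). (int p * x, int p * y))"
  define S where "S = {z. int p * norm_form z = int n}"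
  have norm_scale: "norm_form (k * x, k * y) = k * (k * norm_form (x, y))" for k x y
    by (simp add: norm_form_def power2_eq_square algebra_simps)
  have inj_h: "inj h" using p0 by (auto simp: inj_def h_def)
  have "reps (p * n) = h ` S"
  proof (intro equalityI subsetI)
    fix z assume "z \<in> h ` S"
    thus "z \<in> reps (p * n)" by (auto simp: h_def S_def reps_def norm_scale)
  next
    fix z assume z: "z \<in> reps (p * n)"
    obtain x y where xy: "z = (x, y)" by force
    have nz: "norm_form (x, y) = int p * int n" using z by (simp add: reps_def xy)
    then obtain x' y' where x'y': "x = int p * x'" "y = int p * y'"
      using prime_2_mod_3_dvd_norm_form[OF p, of x y] by (metis dvdE dvd_triv_left)
    have "int p * (int p * norm_form (x', y')) = int p * int n"
      using nz by (simp add: x'y' norm_scale)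
    hence "(x', y') \<in> S" using p0 by (simp add: S_def)
    thus "z \<in> h ` S" by (auto simp: h_def xy x'y')
  qed
  hence "wsum W (p * n) = (\<Sum>z\<in>h ` S. W z)" by (simp add: wsum_def)
  also have "\<dots> = (\<Sum>z\<in>S. W z)"
    using inj_h by (subst sum.reindex) (auto intro: inj_on_subset sum.cong simp: h_def W)
  also have "\<dots> = (if p dvd n then wsum W (n div p) else 0)"
  proof (cases "p dvd n")
    case True
    then obtain k where k: "n = p * k" by (elim dvdE)
    have "S = reps k" using p0 by (auto simp: S_def reps_def k)
    thus ?thesis using k p0 by (simp add: wsum_def)
  next
    case False
    have "S = {}"
    proof (rule ccontr)
      assume "S \<noteq> {}"
      then obtain z where "int p * norm_form z = int n" by (auto simp: S_def)
      hence "int p dvd int n" by (metis dvd_triv_left)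
      thus False using False by simp
    qed
    thus ?thesis using False by simp
  qed
  finally show ?thesis .
qed

section \<open>From recursions at primes to products over prime factors\<close>

text \<open>\<open>C v\<close> is the local factor. The pairs (t, e) that occur are (2, -1) with C v
  = v + 1, (-1, -1) with the periodic values 1, -1, 0, and (0, 1) for inert primes, with C v = 1 or
  0 by the parity of v.\<close>

lemma prime_power_recurrence:
  fixes F :: "nat \<Rightarrow> int" and C :: "nat \<Rightarrow> int"
  assumes p: "prime p" and m: "\<not> p dvd m"
    and F: "\<And>n. F (p * n) = t * F n + e * (if p dvd n then F (n div p) else 0)"
    and C: "C 0 = 1" "C 1 = t" "\<And>v. C (Suc (Suc v)) = t * C (Suc v) + e * C v"
  shows "F (p ^ v * m) = C v * F m"
proof (induction v rule: induct_nat_012)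
  case 0
  show ?case by (simp add: C)
next
  case 1
  show ?case using F[of m] m by (simp add: C(2)[simplified])
next
  case (ge2 v)
  have "F (p ^ Suc (Suc v) * m) = F (p * (p ^ Suc v * m))" by (simp add: mult_ac)
  also have "\<dots> = t * F (p ^ Suc v * m) + e * F (p ^ v * m)"
    using F[of "p ^ Suc v * m"] prime_gt_0_nat[OF p] by (simp add: mult_ac)
  finally show ?case using ge2 by (simp add: C(3) algebra_simps)
qed

text \<open>\<open>good\<close> marks the primes with a known local factor: 3 is excluded
  throughout, and 2 as well for the parity weight.\<close>

lemma prod_over_prime_factors:
  fixes F :: "nat \<Rightarrow> real" and loc :: "nat \<Rightarrow> nat \<Rightarrow> real"
  assumes F: "\<And>p v m. prime p \<Longrightarrow> good p \<Longrightarrow> \<not> p dvd m \<Longrightarrow> F (p ^ v * m) = loc p v * F m"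
    and n: "n > 0" "\<And>p. prime p \<Longrightarrow> p dvd n \<Longrightarrow> good p"
  shows "F n = F 1 * (\<Prod>p\<in>prime_factors n. loc p (multiplicity p n))"
  using n
proof (induction n rule: less_induct)
  case (less n)
  show ?case
  proof (cases "n = 1")
    case False
    then obtain p where p: "prime p" "p dvd n" using prime_factor_nat by blast
    define v where "v = multiplicity p n"
    obtain m where m: "n = p ^ v * m" "\<not> p dvd m"
      using multiplicity_decompose'[of n p] p less.prems(1) not_prime_unit[of p] unfolding v_def
      by (metis neq0_conv)
    have v: "v > 0" using p less.prems(1) by (simp add: v_def prime_multiplicity_gt_zero_iff)
    have m0: "m > 0" using m less.prems(1) by (intro Nat.gr0I) auto
    have "1 < p ^ v" by (rule one_less_power[OF prime_gt_1_nat[OF p(1)] v])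
    hence "m < n" using m0 unfolding m(1) by simp
    moreover have "good q" if "prime q" "q dvd m" for q
      using less.prems(2)[of q] that m(1) by simp
    ultimately have IH: "F m = F 1 * (\<Prod>q\<in>prime_factors m. loc q (multiplicity q m))"
      using less.IH m0 by blast
    have pf: "prime_factors n = insert p (prime_factors m)"
      unfolding m(1) using p(1) v m0
      by (subst prime_factors_product) (auto simp: prime_factorization_prime_power prime_prime_factors)
    have mult: "multiplicity q n = multiplicity q m" if "q \<in> prime_factors m" for q
    proof -
      have q: "prime q" "q \<noteq> p" using that m(2) by auto
      hence "\<not> q dvd p ^ v" using p(1) by (metis prime_dvd_power primes_dvd_imp_eq)
      thus ?thesis unfolding m(1) using q p(1) m0
        by (subst prime_elem_multiplicity_mult_distrib) (auto simp: not_dvd_imp_multiplicity_0)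
    qed
    have "F n = loc p v * F m" unfolding m(1) using p less.prems(2) m(2) by (intro F) auto
    also have "\<dots> = F 1 * (loc p v * (\<Prod>q\<in>prime_factors m. loc q (multiplicity q m)))" by (simp add: IH)
    also have "(\<Prod>q\<in>prime_factors m. loc q (multiplicity q m)) = (\<Prod>q\<in>prime_factors m. loc q (multiplicity q n))"
      by (intro prod.cong) (simp_all add: mult)
    also have "loc p v * \<dots> = (\<Prod>q\<in>prime_factors n. loc q (multiplicity q n))"
      unfolding pf v_def using m(2) by (subst prod.insert) auto
    finally show ?thesis .
  qed simp
qed

section \<open>Counting representations\<close>

lemma card_eqI:
  assumes "\<And>a. a \<in> A \<Longrightarrow> f a \<in> B" "\<And>b. b \<in> B \<Longrightarrow> g b \<in> A"
    and "\<And>a. a \<in> A \<Longrightarrow> g (f a) = a" "\<And>b. b \<in> B \<Longrightarrow> f (g b) = b"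
  shows "card A = card B"
  by (rule bij_betw_same_card[of f], rule bij_betwI[of f A B g]) (use assms in auto)

text \<open>Modulo 2, x + 3 y omega becomes x + y omega in the field with four elements. The weight
  is psi + conj psi for a cubic character psi of its unit group, extended by 0. Conjugation in
  Z[omega] induces squaring on this field, so multiplication by an element of odd norm and by its
  conjugate together act on the weight by a scalar, the weight of that element.\<close>

definition parity_weight :: "int \<times> int \<Rightarrow> int" where
  "parity_weight = (\<lambda>(x, y). if even x \<and> even y then 0 else if even y then 2 else -1)"

lemma Legendre_3: "Legendre a 3 = (if a mod 3 = 0 then 0 else if a mod 3 = 1 then 1 else -1)"
proof -
  have "QuadRes 3 a \<longleftrightarrow> a mod 3 = 0 \<or> a mod 3 = 1"
  proof
    assume "QuadRes 3 a"
    then obtain y where y: "y\<^sup>2 mod 3 = a mod 3" by (auto simp: QuadRes_def cong_def)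
    have "y\<^sup>2 mod 3 = (y mod 3)\<^sup>2 mod 3" by (simp add: power_mod)
    moreover have "y mod 3 = 0 \<or> y mod 3 = 1 \<or> y mod 3 = 2" by presburger
    ultimately show "a mod 3 = 0 \<or> a mod 3 = 1" using y by auto
  next
    assume "a mod 3 = 0 \<or> a mod 3 = 1"
    hence "[0\<^sup>2 = a] (mod 3) \<or> [1\<^sup>2 = a] (mod 3)" by (auto simp: cong_def)
    thus "QuadRes 3 a" unfolding QuadRes_def by blast
  qed
  thus ?thesis by (auto simp: Legendre_def cong_def)
qed

lemma primes_coprime_3_cases:
  fixes p :: nat
  assumes "prime p" "\<not> 3 dvd n" "p dvd n"
  obtains "[p = 1] (mod 3)" "p > 3" | "[p = 2] (mod 3)"
proof -
  have "\<not> 3 dvd p" using assms dvd_trans by blast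
  hence "p mod 3 = 1 \<or> p mod 3 = 2" by presburger
  moreover have "p > 3" if "p mod 3 = 1"
  proof (rule ccontr)
    assume "\<not> p > 3"
    hence "p = 0 \<or> p = 1 \<or> p = 2 \<or> p = 3" by auto
    thus False using that prime_gt_1_nat[OF assms(1)] by auto
  qed
  ultimately show ?thesis using that by (auto simp: cong_def)
qed

text \<open>The only units of Z[3 omega] are 1 and -1, since omega does not belong to it. The
  starting values 2 and 4 of the two sums come from here.\<close>

lemma wsum_1: "wsum W 1 = W (1, 0) + W (-1, 0)"
proof -
  have "reps 1 = {(1, 0), (-1, 0)}"
  proof (intro equalityI subsetI)
    fix z assume z: "z \<in> reps 1"
    obtain x y where xy: "z = (x, y)" by force
    have n: "x\<^sup>2 - 3 * x * y + 9 * y\<^sup>2 = 1" using z by (simp add: reps_def norm_form_def xy)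
    hence "4 = (2 * x - 3 * y)\<^sup>2 + 27 * y\<^sup>2" by (simp add: power2_eq_square algebra_simps)
    hence "27 * y\<^sup>2 \<le> 4" using zero_le_power2[of "2 * x - 3 * y"] by linarith
    hence "y\<^sup>2 < 1" by simp
    hence "y = 0" by (metis int_one_le_iff_zero_less linorder_not_le zero_less_power2)
    thus "z \<in> {(1, 0), (-1, 0)}" using n by (auto simp: xy power2_eq_1_iff)
  qed (auto simp: reps_def norm_form_def)
  thus ?thesis by (simp add: wsum_def)
qed

lemma alternating_half: "(1 + (-1) ^ v) / 2 = (of_int (if even v then 1 else 0) :: real)"
  by simp

lemma wsum_inert_power:
  assumes p: "prime p" "[p = 2] (mod 3)" "\<not> p dvd m"
    and W: "\<And>x y. W (int p * x, int p * y) = W (x, y)"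
  shows "real_of_int (wsum W (p ^ v * m)) = (1 + (-1) ^ v) / 2 * real_of_int (wsum W m)"
proof -
  have "wsum W (p ^ v * m) = (if even v then 1 else 0) * wsum W m"
    by (rule prime_power_recurrence[OF p(1,3), where t = 0 and e = 1])
       (use wsum_prime_inert[OF p(1,2) W] in auto)
  thus ?thesis unfolding alternating_half by (simp only: of_int_mult)
qed

lemma card_reps_formula:
  assumes n: "n > 0" "\<not> 3 dvd n"
  shows "real (card (reps n)) = (1 + (-1) ^ multiplicity 2 n)
           * (\<Prod>p\<in>{p \<in> prime_factors n. [p = 1] (mod 3)}. 1 + real (multiplicity p n))
           * (\<Prod>p\<in>{p \<in> prime_factors n. p \<noteq> 2 \<and> [p = 2] (mod 3)}. (1 + (-1) ^ multiplicity p n) / 2)"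
proof -
  define W :: "int \<times> int \<Rightarrow> int" where "W = (\<lambda>_. 1)"
  define loc :: "nat \<Rightarrow> nat \<Rightarrow> real" where
    "loc p v = (if [p = 1] (mod 3) then 1 + real v else (1 + (-1) ^ v) / 2)" for p v
  have loc: "real_of_int (wsum W (p ^ v * m)) = loc p v * real_of_int (wsum W m)"
    if p: "prime p" "\<not> 3 dvd p" "\<not> p dvd m" for p v m
  proof -
    from p(1,2) dvd_refl show ?thesis
    proof (cases rule: primes_coprime_3_cases)
      case 1
      obtain c d where "norm_form (c, d) = int p"
        using prime_norm_form_representation[OF p(1) 1(1)] by (auto simp: norm_form_def)
      from wsum_prime_split[OF p(1) 1(2) this, of W 2]
      have "wsum W (p ^ v * m) = (1 + int v) * wsum W m"
        by (intro prime_power_recurrence[OF p(1,3), where t = 2 and e = "-1"]) (auto simp: W_def)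
      thus ?thesis using 1 by (simp add: loc_def)
    next
      case 2
      have "\<not> [p = 1] (mod 3)" using 2 by (auto simp: cong_def)
      thus ?thesis using wsum_inert_power[OF p(1) 2 p(3), of W v] by (simp add: loc_def W_def)
    qed
  qed
  have "real_of_int (wsum W n) = real_of_int (wsum W 1) * (\<Prod>p\<in>prime_factors n. loc p (multiplicity p n))"
  proof (rule prod_over_prime_factors[where good = "\<lambda>p. \<not> 3 dvd p"])
    show "\<not> 3 dvd p" if "p dvd n" for p using n(2) that dvd_trans by blast
  qed (use n loc in auto)
  also have "wsum W 1 = 2" unfolding wsum_1 by (simp add: W_def)
  also have "real_of_int 2 * (\<Prod>p\<in>prime_factors n. loc p (multiplicity p n)) =
      real_of_int 2 * (\<Prod>p\<in>prime_factors n. (if p = 2 then (1 + (-1) ^ multiplicity p n) / 2 else 1)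
        * ((if [p = 1] (mod 3) then 1 + real (multiplicity p n) else 1)
        * (if p \<noteq> 2 \<and> [p = 2] (mod 3) then (1 + (-1) ^ multiplicity p n) / 2 else 1)))"
  proof (intro arg_cong[where f = "(*) (real_of_int 2)"] prod.cong refl)
    fix p assume "p \<in> prime_factors n"
    hence p: "prime p" "p dvd n" by auto
    from p(1) n(2) p(2)
    show "loc p (multiplicity p n) = (if p = 2 then (1 + (-1) ^ multiplicity p n) / 2 else 1)
        * ((if [p = 1] (mod 3) then 1 + real (multiplicity p n) else 1)
        * (if p \<noteq> 2 \<and> [p = 2] (mod 3) then (1 + (-1) ^ multiplicity p n) / 2 else 1))"
    proof (cases rule: primes_coprime_3_cases)
      case 1
      have "\<not> [p = 2] (mod 3)" using 1 by (auto simp: cong_def)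
      thus ?thesis using 1 by (simp add: loc_def)
    next
      case 2
      have "\<not> [p = 1] (mod 3)" using 2 by (auto simp: cong_def)
      thus ?thesis using 2 by (simp add: loc_def)
    qed
  qed
  also have "\<dots> = (real_of_int 2 * (\<Prod>p\<in>prime_factors n. if p = 2 then (1 + (-1) ^ multiplicity p n) / 2 else 1))
        * (\<Prod>p\<in>{p \<in> prime_factors n. [p = 1] (mod 3)}. 1 + real (multiplicity p n))
        * (\<Prod>p\<in>{p \<in> prime_factors n. p \<noteq> 2 \<and> [p = 2] (mod 3)}. (1 + (-1) ^ multiplicity p n) / 2)"
    unfolding prod.distrib by (simp add: prod.inter_filter)
  \<comment> \<open>The starting value 2 is merged with the local factor of the inert prime 2; for
    odd n that factor is absent and 1 + (-1)^0 is the 2 itself.\<close>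
  also have "real_of_int 2 * (\<Prod>p\<in>prime_factors n. if p = 2 then (1 + (-1) ^ multiplicity p n) / 2 else 1) =
               1 + (-1) ^ multiplicity 2 n"
  proof (cases "2 dvd n")
    case True
    hence "2 \<in> prime_factors n" using n(1) by (simp add: in_prime_factors_iff)
    thus ?thesis by (simp add: prod.delta)
  next
    case False
    hence "2 \<notin> prime_factors n" by auto
    thus ?thesis using False by (simp add: prod.delta not_dvd_imp_multiplicity_0)
  qed
  finally show ?thesis by (simp add: wsum_def W_def)
qed

text \<open>The eigenvalue at a prime p congruent to 1 mod 3 is 2 or -1 according to whether 2 is a
  cubic residue. In the second case the local factors 1, -1, 0 are the Legendre symbols of v + 1
  modulo 3. Multiplication by 2 sends every parity class to 0, hence the restriction to odd
  n.\<close>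

lemma wsum_parity_formula:
  assumes n: "n > 0" "\<not> 3 dvd n" "odd n"
  shows "real_of_int (wsum parity_weight n) = 4
           * (\<Prod>p\<in>{p \<in> prime_factors n. [p = 1] (mod 3) \<and> [2 ^ ((p - 1) div 3) = 1] (mod p)}.
                1 + real (multiplicity p n))
           * (\<Prod>p\<in>{p \<in> prime_factors n. [p = 1] (mod 3) \<and> \<not> [2 ^ ((p - 1) div 3) = 1] (mod p)}.
                real_of_int (Legendre (1 + int (multiplicity p n)) 3))
           * (\<Prod>p\<in>{p \<in> prime_factors n. p \<noteq> 2 \<and> [p = 2] (mod 3)}. (1 + (-1) ^ multiplicity p n) / 2)"
proof -
  define cub where "cub p \<longleftrightarrow> [2 ^ ((p - 1) div 3) = 1] (mod p)" for p :: nat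
  define loc :: "nat \<Rightarrow> nat \<Rightarrow> real" where
    "loc p v = (if [p = 1] (mod 3) then if cub p then 1 + real v else real_of_int (Legendre (1 + int v) 3)
                else (1 + (-1) ^ v) / 2)" for p v
  have loc: "real_of_int (wsum parity_weight (p ^ v * m)) = loc p v * real_of_int (wsum parity_weight m)"
    if p: "prime p" "\<not> 3 dvd p \<and> odd p" "\<not> p dvd m" for p v m
  proof -
    have scale: "parity_weight (int p * x, int p * y) = parity_weight (x, y)" for x y
      using p(2) by (simp add: parity_weight_def)
    from p(1) conjunct1[OF p(2)] dvd_refl show ?thesis
    proof (cases rule: primes_coprime_3_cases)
      case 1
      obtain c d where cd: "norm_form (c, d) = int p" "even d \<longleftrightarrow> cub p"
        using prime_norm_form_representation[OF p(1) 1(1)] by (auto simp: norm_form_def cub_def)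
      \<comment> \<open>As p is odd, c + 3 d omega is a unit modulo 2, so its weight is 2 for even d
        and -1 for odd d.\<close>
      have "odd (norm_form (c, d))" using cd(1) p(2) by simp
      hence "odd c \<or> odd d" by (auto simp: norm_form_def)
      hence w: "parity_weight (case z of (x, y) \<Rightarrow> (c * x - 9 * d * y, c * y + d * x - 3 * d * y)) +
               parity_weight (case z of (x, y) \<Rightarrow> ((c - 3 * d) * x + 9 * d * y, c * y - d * x)) =
               (if cub p then 2 else -1) * parity_weight z" for z
        unfolding cd(2)[symmetric] by (cases z) (auto simp: parity_weight_def)
      note split = wsum_prime_split[OF p(1) 1(2) cd(1) w scale]
      show ?thesis
      proof (cases "cub p")
        case True
        have "wsum parity_weight (p ^ v * m) = (1 + int v) * wsum parity_weight m"
          using split True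
          by (intro prime_power_recurrence[OF p(1,3), where t = 2 and e = "-1"]) auto
        thus ?thesis using 1 True by (simp add: loc_def)
      next
        case False
        have "wsum parity_weight (p ^ v * m) = Legendre (1 + int v) 3 * wsum parity_weight m"
        proof (rule prime_power_recurrence[OF p(1,3), where t = "-1" and e = "-1"])
          show "Legendre (1 + int (Suc (Suc v))) 3 = - 1 * Legendre (1 + int (Suc v)) 3 + - 1 * Legendre (1 + int v) 3" for v
          proof -
            consider "v mod 3 = 0" | "v mod 3 = 1" | "v mod 3 = 2" by linarith
            thus ?thesis
            proof cases
              case 1
              hence "(1 + int v) mod 3 = 1" "(1 + int (Suc v)) mod 3 = 2" "(1 + int (Suc (Suc v))) mod 3 = 0"
                by presburger+
              thus ?thesis by (simp only: Legendre_3) simp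
            next
              case 2
              hence "(1 + int v) mod 3 = 2" "(1 + int (Suc v)) mod 3 = 0" "(1 + int (Suc (Suc v))) mod 3 = 1"
                by presburger+
              thus ?thesis by (simp only: Legendre_3) simp
            next
              case 3
              hence "(1 + int v) mod 3 = 0" "(1 + int (Suc v)) mod 3 = 1" "(1 + int (Suc (Suc v))) mod 3 = 2"
                by presburger+
              thus ?thesis by (simp only: Legendre_3) simp
            qed
          qed
        qed (use split False in \<open>auto simp: Legendre_3\<close>)
        thus ?thesis using 1 False by (simp add: loc_def)
      qed
    next
      case 2
      have "\<not> [p = 1] (mod 3)" using 2 by (auto simp: cong_def)
      thus ?thesis using wsum_inert_power[OF p(1) 2 p(3), of parity_weight v] scale by (simp add: loc_def)
    qed
  qed
  have "real_of_int (wsum parity_weight n) =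
          real_of_int (wsum parity_weight 1) * (\<Prod>p\<in>prime_factors n. loc p (multiplicity p n))"
  proof (rule prod_over_prime_factors[where good = "\<lambda>p. \<not> 3 dvd p \<and> odd p"])
    show "\<not> 3 dvd p \<and> odd p" if "p dvd n" for p using n(2,3) that dvd_trans by blast
  qed (use n loc in auto)
  also have "wsum parity_weight 1 = 4" unfolding wsum_1 by (simp add: parity_weight_def)
  also have "(\<Prod>p\<in>prime_factors n. loc p (multiplicity p n)) =
      (\<Prod>p\<in>prime_factors n. (if [p = 1] (mod 3) \<and> cub p then 1 + real (multiplicity p n) else 1)
        * ((if [p = 1] (mod 3) \<and> \<not> cub p then real_of_int (Legendre (1 + int (multiplicity p n)) 3) else 1)
        * (if p \<noteq> 2 \<and> [p = 2] (mod 3) then (1 + (-1) ^ multiplicity p n) / 2 else 1)))"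
  proof (intro prod.cong refl)
    fix p assume "p \<in> prime_factors n"
    hence p: "prime p" "p dvd n" by auto
    have p2: "p \<noteq> 2" using n(3) p(2) by auto
    from p(1) n(2) p(2)
    show "loc p (multiplicity p n) = (if [p = 1] (mod 3) \<and> cub p then 1 + real (multiplicity p n) else 1)
        * ((if [p = 1] (mod 3) \<and> \<not> cub p then real_of_int (Legendre (1 + int (multiplicity p n)) 3) else 1)
        * (if p \<noteq> 2 \<and> [p = 2] (mod 3) then (1 + (-1) ^ multiplicity p n) / 2 else 1))"
    proof (cases rule: primes_coprime_3_cases)
      case 1
      have "\<not> [p = 2] (mod 3)" using 1 by (auto simp: cong_def)
      thus ?thesis using 1 by (simp add: loc_def)
    next
      case 2
      have "\<not> [p = 1] (mod 3)" using 2 by (auto simp: cong_def)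
      thus ?thesis using 2 p2 by (simp add: loc_def)
    qed
  qed
  finally show ?thesis
    unfolding prod.distrib by (simp add: prod.inter_filter cub_def)
qed

section \<open>The two forms as parity classes of the norm form\<close>

text \<open>For y = 2y' the norm form is (x - 3y')^2 + 27y'^2.\<close>

lemma rep_a_eq: "rep_a n = card {z \<in> reps n. even (snd z)}"
  unfolding rep_a_def
proof (rule card_eqI[where f = "\<lambda>(x, y). (x + 3 * y, 2 * y)" and g = "\<lambda>(x, y). (x - 3 * (y div 2), y div 2)"])
  fix z assume "z \<in> {z \<in> reps n. even (snd z)}"
  then obtain x y where "z = (x, 2 * y)" "norm_form (x, 2 * y) = int n"
    by (cases z) (auto simp: reps_def elim!: evenE)
  thus "(case z of (x, y) \<Rightarrow> (x - 3 * (y div 2), y div 2)) \<in> {(x, y). x\<^sup>2 + 27 * y\<^sup>2 = int n}"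
    by (simp add: norm_form_def power2_eq_square algebra_simps)
qed (auto simp: reps_def norm_form_def power2_eq_square algebra_simps)

text \<open>The substitution x = 2(x' + y) turns the norm form into 4x'^2 + 2x'y + 7y^2.\<close>

lemma rep_b_eq: "rep_b n = card {z \<in> reps n. even (fst z)}"
  unfolding rep_b_def
proof (rule card_eqI[where f = "\<lambda>(x, y). (2 * (x + y), y)" and g = "\<lambda>(x, y). (x div 2 - y, y)"])
  fix z assume "z \<in> {z \<in> reps n. even (fst z)}"
  then obtain x y where "z = (2 * x, y)" "norm_form (2 * x, y) = int n"
    by (cases z) (auto simp: reps_def elim!: evenE)
  thus "(case z of (x, y) \<Rightarrow> (x div 2 - y, y)) \<in> {(x, y). 4 * x\<^sup>2 + 2 * x * y + 7 * y\<^sup>2 = int n}"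
    by (simp add: norm_form_def power2_eq_square algebra_simps)
qed (auto simp: reps_def norm_form_def power2_eq_square algebra_simps)

text \<open>The map is conjugation of x + 3 y omega, which exchanges the classes of omega and
  omega^2 modulo 2.\<close>

lemma rep_b_eq': "rep_b n = card {z \<in> reps n. even (fst z + snd z)}"
  unfolding rep_b_eq
  by (rule card_eqI[where f = "\<lambda>(x, y). (x - 3 * y, - y)" and g = "\<lambda>(x, y). (x - 3 * y, - y)"])
     (auto simp: reps_def norm_form_def power2_eq_square algebra_simps)

lemma reps_parity:
  assumes "(x, y) \<in> reps n"
  shows "even n \<longleftrightarrow> even x \<and> even y"
proof -
  have "even (int n) \<longleftrightarrow> even (x\<^sup>2 - 3 * x * y + 9 * y\<^sup>2)" using assms by (simp add: reps_def norm_form_def)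
  thus ?thesis by auto
qed

lemma rep_even:
  assumes "even n"
  shows "rep_a n = card (reps n)" "rep_b n = card (reps n)"
proof -
  have "{z \<in> reps n. even (snd z)} = reps n" "{z \<in> reps n. even (fst z)} = reps n"
    using reps_parity[of _ _ n] assms by auto
  thus "rep_a n = card (reps n)" "rep_b n = card (reps n)" by (simp_all add: rep_a_eq rep_b_eq)
qed

lemma rep_odd:
  assumes "odd n"
  shows "card (reps n) = rep_a n + 2 * rep_b n" "wsum parity_weight n = 2 * int (rep_a n) - 2 * int (rep_b n)"
proof -
  define A where "A = {z \<in> reps n. even (snd z)}"
  define B where "B = {z \<in> reps n. even (fst z)}"
  define C where "C = {z \<in> reps n. even (fst z + snd z)}"
  have fin: "finite A" "finite B" "finite C" using finite_reps[of n] by (auto simp: A_def B_def C_def)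
  have U: "reps n = A \<union> (B \<union> C)" by (auto simp: A_def B_def C_def)
  have disj: "A \<inter> (B \<union> C) = {}" "B \<inter> C = {}"
    using reps_parity[of _ _ n] assms by (auto simp: A_def B_def C_def)
  have cards: "card A = rep_a n" "card B = rep_b n" "card C = rep_b n"
    by (simp_all add: A_def B_def C_def rep_a_eq rep_b_eq rep_b_eq'[unfolded rep_b_eq])
  show "card (reps n) = rep_a n + 2 * rep_b n"
    unfolding U using fin disj by (simp add: card_Un_disjoint cards)
  have wA: "parity_weight z = 2" if "z \<in> A" for z
    using that reps_parity[of "fst z" "snd z" n] assms
    by (cases z) (auto simp: A_def parity_weight_def)
  have wBC: "parity_weight z = -1" if "z \<in> B \<union> C" for z
    using that reps_parity[of "fst z" "snd z" n] assms
    by (cases z) (auto simp: B_def C_def parity_weight_def)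
  have "wsum parity_weight n = (\<Sum>z\<in>A. parity_weight z) + (\<Sum>z\<in>B \<union> C. parity_weight z)"
    unfolding wsum_def U using fin disj by (intro sum.union_disjoint) auto
  also have "(\<Sum>z\<in>A. parity_weight z) = 2 * int (card A)" using wA by simp
  also have "(\<Sum>z\<in>B \<union> C. parity_weight z) = - int (card (B \<union> C))" using wBC by simp
  also have "card (B \<union> C) = 2 * rep_b n" using fin disj by (simp add: card_Un_disjoint cards)
  finally show "wsum parity_weight n = 2 * int (rep_a n) - 2 * int (rep_b n)" by (simp add: cards)
qed

section \<open>Multiples of 3 and the full ring of Eisenstein integers\<close>

text \<open>The norm form of Z[omega] itself: an element of Z[3 omega] of norm 9n is 3 times an
  element of Z[omega] of norm n.\<close>

definition eisenstein_reps :: "nat \<Rightarrow> (int \<times> int) set" where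
  "eisenstein_reps n = {(x, y). x\<^sup>2 - x * y + y\<^sup>2 = int n}"

lemma finite_eisenstein_reps: "finite (eisenstein_reps n)"
proof (rule inj_on_finite)
  show "inj_on (\<lambda>(x, y). (3 * x, y)) (eisenstein_reps n)" by (auto simp: inj_on_def)
  show "(\<lambda>(x, y). (3 * x, y)) ` eisenstein_reps n \<subseteq> reps (9 * n)"
    by (auto simp: eisenstein_reps_def reps_def norm_form_def power2_eq_square)
qed (rule finite_reps)

lemma reps_3_dvd:
  assumes "(x, y) \<in> reps (3 * n)"
  shows "3 dvd x" "3 dvd n"
proof -
  have n: "x\<^sup>2 - 3 * x * y + 9 * y\<^sup>2 = 3 * int n" using assms by (simp add: reps_def norm_form_def)
  hence "x\<^sup>2 = 3 * (int n + x * y - 3 * y\<^sup>2)" by (simp add: algebra_simps)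
  hence "3 dvd x\<^sup>2" by simp
  hence "3 dvd x" using prime_dvd_power[of "3::int" x 2] by simp
  then obtain k where "x = 3 * k" by (elim dvdE)
  hence "int n = 3 * (k\<^sup>2 - k * y + y\<^sup>2) * 1" using n by (simp add: power2_eq_square)
  hence "3 dvd int n" by simp
  thus "3 dvd x" "3 dvd n" using \<open>3 dvd x\<close> by presburger+
qed

lemma card_reps_9: "card (reps (9 * n)) = card (eisenstein_reps n)"
proof (rule card_eqI[where f = "\<lambda>(x, y). (x div 3, y)" and g = "\<lambda>(x, y). (3 * x, y)"])
  have dvd: "3 dvd fst z" if "z \<in> reps (9 * n)" for z
    using reps_3_dvd(1)[of "fst z" "snd z" "3 * n"] that by simp
  fix z assume z: "z \<in> reps (9 * n)"
  then obtain x y where xy: "z = (3 * x, y)" using dvd[OF z] by (cases z) auto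
  show "(case z of (x, y) \<Rightarrow> (x div 3, y)) \<in> eisenstein_reps n"
    using z by (simp add: xy reps_def norm_form_def eisenstein_reps_def power2_eq_square)
  show "(case (case z of (x, y) \<Rightarrow> (x div 3, y)) of (x, y) \<Rightarrow> (3 * x, y)) = z" by (simp add: xy)
qed (auto simp: eisenstein_reps_def reps_def norm_form_def power2_eq_square)

text \<open>All solutions lie in 3 Z[omega], which is stable under multiplication by omega. That
  multiplication is \<open>f\<close>; it carries the condition that y is even to the condition that
  x is even.\<close>

lemma rep_odd_9:
  assumes "odd n"
  shows "rep_a (9 * n) = rep_b (9 * n)"
proof -
  have dvd: "3 dvd x" if "(x, y) \<in> reps (9 * n)" for x y
    using reps_3_dvd(1)[of x y "3 * n"] that by simp
  show ?thesis
    unfolding rep_a_eq rep_b_eq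
  proof (rule card_eqI[where f = "\<lambda>(x, y). (- 3 * y, x div 3 - y)" and g = "\<lambda>(x, y). (3 * (y - x div 3), - (x div 3))"])
    fix z assume z: "z \<in> {z \<in> reps (9 * n). even (snd z)}"
    hence "3 dvd fst z" using dvd[of "fst z" "snd z"] by simp
    then obtain x y where xy: "z = (3 * x, y)" by (metis dvdE prod.collapse)
    show "(case z of (x, y) \<Rightarrow> (- 3 * y, x div 3 - y)) \<in> {z \<in> reps (9 * n). even (fst z)}"
      using z by (simp add: xy reps_def norm_form_def power2_eq_square algebra_simps)
    show "(case (case z of (x, y) \<Rightarrow> (- 3 * y, x div 3 - y)) of (x, y) \<Rightarrow> (3 * (y - x div 3), - (x div 3))) = z"
      by (simp add: xy)
  next
    fix z assume z: "z \<in> {z \<in> reps (9 * n). even (fst z)}"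
    hence "3 dvd fst z" using dvd[of "fst z" "snd z"] by simp
    then obtain x y where xy: "z = (3 * x, y)" by (metis dvdE prod.collapse)
    show "(case z of (x, y) \<Rightarrow> (3 * (y - x div 3), - (x div 3))) \<in> {z \<in> reps (9 * n). even (snd z)}"
      using z by (simp add: xy reps_def norm_form_def power2_eq_square algebra_simps)
    show "(case (case z of (x, y) \<Rightarrow> (3 * (y - x div 3), - (x div 3))) of (x, y) \<Rightarrow> (- 3 * y, x div 3 - y)) = z"
      by (simp add: xy)
  qed
qed

text \<open>\<open>g\<close> is multiplication by 1 + 2 omega = sqrt(-3), of norm 3. It is onto
  because a norm divisible by 3 forces 3 | x + y, which means divisibility by sqrt(-3).\<close>

lemma card_eisenstein_reps_3: "card (eisenstein_reps (3 * n)) = card (eisenstein_reps n)"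
proof (rule card_eqI[where f = "\<lambda>(x, y). ((2 * y - x) div 3, (y - 2 * x) div 3)"
                       and g = "\<lambda>(x, y). (x - 2 * y, 2 * x - y)"])
  fix z assume z: "z \<in> eisenstein_reps (3 * n)"
  obtain x y where xy: "z = (x, y)" by force
  have n: "x\<^sup>2 - x * y + y\<^sup>2 = 3 * int n" using z by (simp add: eisenstein_reps_def xy)
  hence "(x + y)\<^sup>2 = 3 * (int n + x * y)" by (simp add: power2_eq_square algebra_simps)
  hence "3 dvd x + y" using prime_dvd_power[of "3::int" "x + y" 2] by simp
  then obtain k where "x + y = 3 * k" by (elim dvdE)
  hence k: "y = 3 * k - x" by simp
  have j: "(2 * y - x) div 3 = 2 * k - x" "(y - 2 * x) div 3 = k - x" unfolding k by simp_all
  show "(case z of (x, y) \<Rightarrow> ((2 * y - x) div 3, (y - 2 * x) div 3)) \<in> eisenstein_reps n"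
    using n unfolding xy prod.case j by (simp add: eisenstein_reps_def k power2_eq_square algebra_simps)
  show "(case (case z of (x, y) \<Rightarrow> ((2 * y - x) div 3, (y - 2 * x) div 3)) of
           (x, y) \<Rightarrow> (x - 2 * y, 2 * x - y)) = z"
    unfolding xy prod.case j by (simp add: k)
qed (auto simp: eisenstein_reps_def power2_eq_square algebra_simps)

lemma card_eisenstein_reps_power_3: "card (eisenstein_reps (3 ^ k * n)) = card (eisenstein_reps n)"
  by (induction k) (simp_all add: mult.assoc card_eisenstein_reps_3)

(* Multiplication by a primitive cube root of unity permutes the three residue classes. *)
lemma card_eisenstein_reps:
  assumes "\<not> 3 dvd n"
  shows "card (eisenstein_reps n) = 3 * card (reps n)"
proof -
  define A where "A = {z \<in> eisenstein_reps n. 3 dvd snd z}"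
  define B where "B = {z \<in> eisenstein_reps n. 3 dvd fst z}"
  define C where "C = {z \<in> eisenstein_reps n. 3 dvd fst z - snd z}"
  have not_dvd: "\<not> 3 dvd x + y" if "(x, y) \<in> eisenstein_reps n" for x y
  proof
    assume d: "3 dvd x + y"
    have "int n = (x + y)\<^sup>2 - 3 * (x * y)" using that by (simp add: eisenstein_reps_def power2_eq_square algebra_simps)
    also have "3 dvd \<dots>" using d by (simp add: power2_eq_square)
    finally show False using assms by presburger
  qed
  have fin: "finite A" "finite B" "finite C" using finite_eisenstein_reps[of n] by (auto simp: A_def B_def C_def)
  \<comment> \<open>Exactly one of y, x, x - y is divisible by 3. The class with 3 | y is the order
    Z[3 omega], counted by \<open>reps\<close>.\<close>
  have tri: "3 dvd y \<or> 3 dvd x \<or> 3 dvd x - y" "\<not> (3 dvd y \<and> 3 dvd x)" "\<not> (3 dvd y \<and> 3 dvd x - y)"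
       "\<not> (3 dvd x \<and> 3 dvd x - y)" if "\<not> 3 dvd x + y" for x y :: int
    using that by presburger+
  have not_dvd': "\<not> 3 dvd fst z + snd z" if "z \<in> eisenstein_reps n" for z
    using not_dvd[of "fst z" "snd z"] that by simp
  have U: "eisenstein_reps n = A \<union> (B \<union> C)"
    unfolding A_def B_def C_def using tri(1)[OF not_dvd'] by blast
  have disj: "A \<inter> (B \<union> C) = {}" "B \<inter> C = {}"
    unfolding A_def B_def C_def using tri(2-4)[OF not_dvd'] by blast+
  have "card A = card B"
    unfolding A_def B_def
    by (rule card_eqI[where f = "\<lambda>(x, y). (- y, x - y)" and g = "\<lambda>(x, y). (y - x, - x)"])
       (auto simp: eisenstein_reps_def power2_eq_square algebra_simps)
  moreover have "card C = card B"
    unfolding B_def C_def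
    by (rule card_eqI[where g = "\<lambda>(x, y). (- y, x - y)" and f = "\<lambda>(x, y). (y - x, - x)"])
       (auto simp: eisenstein_reps_def power2_eq_square algebra_simps dvd_diff_commute)
  moreover have "card (reps n) = card A"
    unfolding A_def
  proof (rule card_eqI[where f = "\<lambda>(x, y). (x, 3 * y)" and g = "\<lambda>(x, y). (x, y div 3)"])
  qed (auto simp: reps_def norm_form_def eisenstein_reps_def power2_eq_square algebra_simps)
  ultimately show ?thesis
    unfolding U using fin disj by (simp add: card_Un_disjoint)
qed

lemma rep_eq_0_if_5_mod_6:
  assumes "[n = 5] (mod 6)"
  shows "rep_a n = 0" "rep_b n = 0"
proof -
  have "n mod 3 = 2" using assms unfolding cong_def by presburger
  hence n3: "int n mod 3 = 2" by presburger
  have "reps n = {}"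
  proof (rule ccontr)
    assume "reps n \<noteq> {}"
    then obtain x y where "x\<^sup>2 - 3 * x * y + 9 * y\<^sup>2 = int n" by (auto simp: reps_def norm_form_def)
    hence "int n = x\<^sup>2 + 3 * (3 * y\<^sup>2 - x * y)" by (simp add: algebra_simps)
    hence "int n mod 3 = x\<^sup>2 mod 3" by (simp only: mod_mult_self2)
    also have "\<dots> = (x mod 3)\<^sup>2 mod 3" by (simp add: power_mod)
    finally have "(x mod 3)\<^sup>2 mod 3 = 2" using n3 by simp
    moreover have "x mod 3 = 0 \<or> x mod 3 = 1 \<or> x mod 3 = 2" by presburger
    ultimately show False by auto
  qed
  thus "rep_a n = 0" "rep_b n = 0" by (simp_all add: rep_a_eq rep_b_eq)
qed

text \<open>The prime 3 enters none of the factors, so the product for m can be written with the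
  multiplicities in n.\<close>

lemma card_reps_prime_to_3_part:
  assumes n: "n > 0" and m: "n = 3 ^ k * m" "\<not> 3 dvd m"
  shows "real (card (reps m)) = (1 + (-1) ^ multiplicity 2 n)
           * (\<Prod>p\<in>{p \<in> prime_factors n. [p = 1] (mod 3)}. 1 + real (multiplicity p n))
           * (\<Prod>p\<in>{p \<in> prime_factors n. p \<noteq> 2 \<and> [p = 2] (mod 3)}. (1 + (-1) ^ multiplicity p n) / 2)"
proof -
  have m0: "m > 0" using n m(1) by (intro Nat.gr0I) auto
  have mult: "multiplicity p n = multiplicity p m" if p: "prime p" "p \<noteq> 3" for p
  proof -
    have "\<not> p dvd 3 ^ k" using p prime_dvd_power[of p 3 k] primes_dvd_imp_eq[of p 3] by auto
    thus ?thesis unfolding m(1) using p(1) m0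
      by (subst prime_elem_multiplicity_mult_distrib) (auto simp: not_dvd_imp_multiplicity_0)
  qed
  have pf: "p \<in> prime_factors n \<longleftrightarrow> p \<in> prime_factors m" if "p \<noteq> 3" for p
  proof (cases "prime p")
    case True
    have "p dvd n \<longleftrightarrow> p dvd m"
      unfolding m(1) using that True prime_dvd_power[of p 3 k] primes_dvd_imp_eq[of p 3]
      by (auto simp: prime_dvd_mult_iff)
    thus ?thesis using n m0 True by (simp add: in_prime_factors_iff)
  qed (simp add: in_prime_factors_iff)
  have sets: "{p \<in> prime_factors n. [p = 1] (mod 3)} = {p \<in> prime_factors m. [p = 1] (mod 3)}"
    "{p \<in> prime_factors n. p \<noteq> 2 \<and> [p = 2] (mod 3)} = {p \<in> prime_factors m. p \<noteq> 2 \<and> [p = 2] (mod 3)}"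
  proof -
    have "p \<noteq> 3" if "[p = 1] (mod 3) \<or> [p = 2] (mod 3)" for p :: nat
      using that by (auto simp: cong_def)
    thus "{p \<in> prime_factors n. [p = 1] (mod 3)} = {p \<in> prime_factors m. [p = 1] (mod 3)}"
      "{p \<in> prime_factors n. p \<noteq> 2 \<and> [p = 2] (mod 3)} = {p \<in> prime_factors m. p \<noteq> 2 \<and> [p = 2] (mod 3)}"
      using pf by blast+
  qed
  have "(\<Prod>p\<in>{p \<in> prime_factors m. [p = 1] (mod 3)}. 1 + real (multiplicity p n)) =
        (\<Prod>p\<in>{p \<in> prime_factors m. [p = 1] (mod 3)}. 1 + real (multiplicity p m))"
  proof (intro prod.cong refl)
    fix p assume p: "p \<in> {p \<in> prime_factors m. [p = 1] (mod 3)}"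
    hence "p \<noteq> 3" by (auto simp: cong_def)
    thus "1 + real (multiplicity p n) = 1 + real (multiplicity p m)" using p by (simp add: mult in_prime_factors_iff)
  qed
  moreover have "(\<Prod>p\<in>{p \<in> prime_factors m. p \<noteq> 2 \<and> [p = 2] (mod 3)}. (1 + (-1) ^ multiplicity p n) / 2 :: real) =
        (\<Prod>p\<in>{p \<in> prime_factors m. p \<noteq> 2 \<and> [p = 2] (mod 3)}. (1 + (-1) ^ multiplicity p m) / 2)"
  proof (intro prod.cong refl)
    fix p assume p: "p \<in> {p \<in> prime_factors m. p \<noteq> 2 \<and> [p = 2] (mod 3)}"
    hence "p \<noteq> 3" by (auto simp: cong_def)
    thus "(1 + (-1) ^ multiplicity p n) / 2 = ((1 + (-1) ^ multiplicity p m) / 2 :: real)"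
      using p by (simp add: mult in_prime_factors_iff)
  qed
  ultimately show ?thesis
    unfolding sets using card_reps_formula[OF m0 m(2)] mult[of 2] by simp
qed

section \<open>Assembling the two counting formulas\<close>

text \<open>For \<beta> \<ge> 2 the total is 3F. If n is even, both counts equal the total; if n is
  odd, they are equal and a + 2b is the total, so each is F. This is the factor 3 - 2 delta. In the
  remaining vanishing cases, \<beta> = 1 or n congruent to 5 mod 6, there are no solutions at
  all.\<close>

lemma rep_not_1_mod_6:
  fixes n :: nat
  assumes n: "n > 0" "\<not> [n = 1] (mod 6)"
  defines "F \<equiv> (1 + (-1) ^ multiplicity 2 n)
           * (\<Prod>p\<in>{p \<in> prime_factors n. [p = 1] (mod 3)}. 1 + real (multiplicity p n))
           * (\<Prod>p\<in>{p \<in> prime_factors n. p \<noteq> 2 \<and> [p = 2] (mod 3)}. (1 + (-1) ^ multiplicity p n) / 2)"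
  defines "R \<equiv> (if multiplicity 3 n \<ge> 2 then (3 - 2 * of_bool (multiplicity 2 n = 0)) * F
                 else if multiplicity 3 n = 0 \<and> multiplicity 2 n > 0 then F
                 else 0)"
  shows "real (rep_a n) = R \<and> real (rep_b n) = R"
proof -
  define \<beta> where "\<beta> = multiplicity 3 n"
  have "\<not> is_unit (3::nat)" by simp
  then obtain m where m: "n = 3 ^ \<beta> * m" "\<not> 3 dvd m"
    using multiplicity_decompose'[of n 3] n(1) unfolding \<beta>_def by (metis neq0_conv)
  have F: "real (card (reps m)) = F"
    unfolding F_def by (rule card_reps_prime_to_3_part[OF n(1) m])
  have \<alpha>: "multiplicity 2 n = 0 \<longleftrightarrow> odd n"
    using n(1) by (simp add: multiplicity_eq_zero_iff)
  have R: "R = (if \<beta> \<ge> 2 then (3 - 2 * of_bool (odd n)) * F else if \<beta> = 0 \<and> even n then F else 0)"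
    unfolding R_def \<beta>_def neq0_conv[symmetric] \<alpha> by simp
  consider "\<beta> = 0" | "\<beta> = 1" | k where "\<beta> = Suc (Suc k)" by (metis One_nat_def not0_implies_Suc)
  thus ?thesis
  proof cases
    case 1
    show ?thesis
    proof (cases "even n")
      case True
      have "m = n" using m(1) 1 by simp
      thus ?thesis using rep_even[OF True] F True 1 by (simp add: R)
    next
      case False
      have "\<not> 3 dvd n" using m 1 by simp
      moreover have "n mod 6 mod 2 = n mod 2" "n mod 6 mod 3 = n mod 3" by (simp_all add: mod_mod_cancel)
      ultimately have "n mod 6 mod 2 \<noteq> 0" "n mod 6 mod 3 \<noteq> 0" "n mod 6 \<noteq> 1" "n mod 6 < 6"
        using n(2) False by (auto simp: cong_def mod_eq_0_iff_dvd)
      moreover have "r = 5" if "r mod 2 \<noteq> 0" "r mod 3 \<noteq> 0" "r \<noteq> 1" "r < 6" for r :: nat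
      proof -
        have "r \<in> {0, 1, 2, 3, 4, 5}" using that(4) by auto
        thus ?thesis using that by auto
      qed
      ultimately have "n mod 6 = 5" by blast
      hence "[n = 5] (mod 6)" by (simp add: cong_def)
      thus ?thesis using rep_eq_0_if_5_mod_6 False 1 by (simp add: R)
    qed
  next
    case 2
    have "reps n = {}"
    proof (rule ccontr)
      assume "reps n \<noteq> {}"
      then obtain x y where "(x, y) \<in> reps (3 * m)" using m(1) 2 by auto
      thus False using reps_3_dvd(2) m(2) by blast
    qed
    thus ?thesis using 2 by (simp add: rep_a_eq rep_b_eq R)
  next
    case 3
    define m' where "m' = 3 ^ k * m"
    have n9: "n = 9 * m'" unfolding m'_def m(1) 3 by simp
    have "card (reps n) = 3 * card (reps m)"
      unfolding n9 card_reps_9 unfolding m'_def card_eisenstein_reps_power_3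
      by (rule card_eisenstein_reps[OF m(2)])
    hence card: "real (card (reps n)) = 3 * F" using F by simp
    show ?thesis
    proof (cases "even n")
      case True
      thus ?thesis using rep_even[OF True] card 3 by (simp add: R)
    next
      case False
      hence eq: "rep_a n = rep_b n" unfolding n9 by (intro rep_odd_9) simp
      show ?thesis using rep_odd(1)[OF False] eq card 3 False by (simp add: R)
    qed
  qed
qed

text \<open>The linear system a + 2b = 2ABC, 2a - 2b = 4ALC is solved for a and b.\<close>

lemma rep_1_mod_6:
  fixes n :: nat
  assumes n: "n > 0" "[n = 1] (mod 6)"
  defines "P \<equiv> {p \<in> prime_factors n. [p = 1] (mod 3) \<and> [2 ^ ((p - 1) div 3) = 1] (mod p)}"
    and "Q \<equiv> {p \<in> prime_factors n. [p = 1] (mod 3) \<and> \<not> [2 ^ ((p - 1) div 3) = 1] (mod p)}"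
  defines "A \<equiv> (\<Prod>p\<in>P. 1 + real (multiplicity p n))"
    and "B \<equiv> (\<Prod>p\<in>Q. 1 + real (multiplicity p n))"
    and "L \<equiv> (\<Prod>p\<in>Q. real_of_int (Legendre (1 + int (multiplicity p n)) 3))"
    and "C \<equiv> (\<Prod>p\<in>{p \<in> prime_factors n. p \<noteq> 2 \<and> [p = 2] (mod 3)}. (1 + (-1) ^ multiplicity p n) / 2)"
  shows "real (rep_a n) = 2 / 3 * A * (B + 2 * L) * C \<and> real (rep_b n) = 2 / 3 * A * (B - L) * C"
proof -
  have odd: "odd n" and n3: "\<not> 3 dvd n"
  proof -
    have "n mod 6 = 1" using n(2) by (simp add: cong_def)
    moreover have "n mod 6 mod 2 = n mod 2" "n mod 6 mod 3 = n mod 3" by (simp_all add: mod_mod_cancel)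
    ultimately have "n mod 2 = 1" "n mod 3 = 1" by simp_all
    thus "odd n" "\<not> 3 dvd n" by (simp_all add: odd_iff_mod_2_eq_one dvd_eq_mod_eq_0)
  qed
  have \<alpha>: "multiplicity 2 n = 0" using odd by (simp add: not_dvd_imp_multiplicity_0)
  have "{p \<in> prime_factors n. [p = 1] (mod 3)} = P \<union> Q" "P \<inter> Q = {}" "finite P" "finite Q"
    by (auto simp: P_def Q_def)
  hence "(\<Prod>p\<in>{p \<in> prime_factors n. [p = 1] (mod 3)}. 1 + real (multiplicity p n)) = A * B"
    by (simp add: A_def B_def prod.union_disjoint)
  hence "real (card (reps n)) = 2 * (A * B) * C"
    using card_reps_formula[OF n(1) n3] by (simp add: \<alpha> C_def)
  hence 1: "real (rep_a n) + 2 * real (rep_b n) = 2 * (A * B) * C"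
    using rep_odd(1)[OF odd] by simp
  have "real_of_int (wsum parity_weight n) = 4 * A * L * C"
    using wsum_parity_formula[OF n(1) n3 odd] by (simp add: A_def L_def C_def P_def Q_def)
  hence 2: "2 * real (rep_a n) - 2 * real (rep_b n) = 4 * A * L * C"
    using rep_odd(2)[OF odd] by simp
  have "3 * real (rep_a n) = 2 * (A * B) * C + 4 * A * L * C" using 1 2 by linarith
  moreover have "3 * real (rep_b n) = 2 * (A * B) * C - 2 * A * L * C" using 1 2 by linarith
  ultimately show ?thesis by (simp add: field_simps)
qed

theorem theorem6p1:
  shows
   "(\<forall>q::complex. norm q < 1 \<longrightarrow>
       ramanujan_phi q * ramanujan_phi (q ^ 27) =
         (ramanujan_phi q * ramanujan_phi (q ^ 3) - ramanujan_phi (q ^ 3) * ramanujan_phi (q ^ 9)) / 3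
         + ramanujan_phi (q ^ 9) * ramanujan_phi (q ^ 27)
         + 4 / 3 * q * euler_E (q ^ 6) * euler_E (q ^ 18)) \<and>
    (\<forall>n::nat. n > 0 \<and> \<not> [n = 1] (mod 6) \<longrightarrow>
       (let \<alpha> = multiplicity 2 n;
            \<beta> = multiplicity 3 n;
            P = {p \<in> prime_factors n. [p = 1] (mod 3)};
            Q = {p \<in> prime_factors n. p \<noteq> 2 \<and> [p = 2] (mod 3)};
            F = (1 + (-1) ^ \<alpha>) * (\<Prod>p\<in>P. 1 + real (multiplicity p n))
                  * (\<Prod>p\<in>Q. (1 + (-1) ^ multiplicity p n) / 2);
            R = (if \<beta> \<ge> 2 then (3 - 2 * of_bool (\<alpha> = 0)) * F
                 else if \<beta> = 0 \<and> \<alpha> > 0 then F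
                 else 0)
        in real (rep_a n) = R \<and> real (rep_b n) = R)) \<and>
    (\<forall>n::nat. n > 0 \<and> [n = 1] (mod 6) \<longrightarrow>
       (let P = {p \<in> prime_factors n. [p = 1] (mod 3) \<and> [2 ^ ((p - 1) div 3) = 1] (mod p)};
            Q = {p \<in> prime_factors n. [p = 1] (mod 3) \<and> \<not> [2 ^ ((p - 1) div 3) = 1] (mod p)};
            T = {p \<in> prime_factors n. p \<noteq> 2 \<and> [p = 2] (mod 3)};
            A = (\<Prod>p\<in>P. 1 + real (multiplicity p n));
            B = (\<Prod>p\<in>Q. 1 + real (multiplicity p n));
            L = (\<Prod>p\<in>Q. real_of_int (Legendre (1 + int (multiplicity p n)) 3));
            C = (\<Prod>p\<in>T. (1 + (-1) ^ multiplicity p n) / 2)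
        in real (rep_a n) = 2 / 3 * A * (B + 2 * L) * C \<and>
           real (rep_b n) = 2 / 3 * A * (B - L) * C))"
proof (intro conjI allI impI)
  fix q :: complex assume "norm q < 1"
  thus "ramanujan_phi q * ramanujan_phi (q ^ 27) =
         (ramanujan_phi q * ramanujan_phi (q ^ 3) - ramanujan_phi (q ^ 3) * ramanujan_phi (q ^ 9)) / 3
         + ramanujan_phi (q ^ 9) * ramanujan_phi (q ^ 27)
         + 4 / 3 * q * euler_E (q ^ 6) * euler_E (q ^ 18)"
    by (rule theta_identity)
next
  fix n :: nat assume n: "n > 0 \<and> \<not> [n = 1] (mod 6)"
  show "let \<alpha> = multiplicity 2 n;
            \<beta> = multiplicity 3 n;
            P = {p \<in> prime_factors n. [p = 1] (mod 3)};
            Q = {p \<in> prime_factors n. p \<noteq> 2 \<and> [p = 2] (mod 3)};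
            F = (1 + (-1) ^ \<alpha>) * (\<Prod>p\<in>P. 1 + real (multiplicity p n))
                  * (\<Prod>p\<in>Q. (1 + (-1) ^ multiplicity p n) / 2);
            R = (if \<beta> \<ge> 2 then (3 - 2 * of_bool (\<alpha> = 0)) * F
                 else if \<beta> = 0 \<and> \<alpha> > 0 then F
                 else 0)
        in real (rep_a n) = R \<and> real (rep_b n) = R"
    unfolding Let_def by (rule rep_not_1_mod_6[OF conjunct1[OF n] conjunct2[OF n]])
next
  fix n :: nat assume n: "n > 0 \<and> [n = 1] (mod 6)"
  show "let P = {p \<in> prime_factors n. [p = 1] (mod 3) \<and> [2 ^ ((p - 1) div 3) = 1] (mod p)};
            Q = {p \<in> prime_factors n. [p = 1] (mod 3) \<and> \<not> [2 ^ ((p - 1) div 3) = 1] (mod p)};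
            T = {p \<in> prime_factors n. p \<noteq> 2 \<and> [p = 2] (mod 3)};
            A = (\<Prod>p\<in>P. 1 + real (multiplicity p n));
            B = (\<Prod>p\<in>Q. 1 + real (multiplicity p n));
            L = (\<Prod>p\<in>Q. real_of_int (Legendre (1 + int (multiplicity p n)) 3));
            C = (\<Prod>p\<in>T. (1 + (-1) ^ multiplicity p n) / 2)
        in real (rep_a n) = 2 / 3 * A * (B + 2 * L) * C \<and>
           real (rep_b n) = 2 / 3 * A * (B - L) * C"
    unfolding Let_def by (rule rep_1_mod_6[OF conjunct1[OF n] conjunct2[OF n]])
qed

end
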